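(* Let $0\le\alpha<\pi$, let $\nu>0$ be real, let $m\ge 1$ be an integer, and write $C_\lambda=C_\lambda^\alpha$. Then the positive zeros of $C_\nu$ and of $R_{m-1,\nu+1}C_{\nu+m}$ are interlaced in the sense that $$0<c_{\nu,k_1}<\tau_{m,\nu,1}<c_{\nu,k_2}<\tau_{m,\nu,2}<\cdots .$$
   Context: For real $\lambda$ and $0\le\alpha<\pi$, the cylinder function is $C_\lambda^\alpha=\cos(\alpha)\,J_\lambda-\sin(\alpha)\,Y_\lambda$ on $(0,\infty)$, where $J_\lambda$ and $Y_\lambda$ are the Bessel functions of the first and second kind of order $\lambda$; $\alpha$ is fixed and suppressed from the notation, the same $\alpha$ being used for all orders. $\{c_{\lambda,k}\}_{k=1}^\infty$ is the sequence of all positive zeros of $C_\lambda$ in increasing order. For a nonnegative integer $n$ and real $\lambda>0$, the Lommel polynomial (a polynomial in $1/x$) is $$R_{n,\lambda}(x)=\sum_{k=0}^{\lfloor n/2\rfloor}(-1)^k\binom{n-k}{k}\frac{\Gamma(\lambda+n-k)}{\Gamma(\lambda+k)}\left(\frac{x}{2}\right)^{2k-n},\qquad x>0.$$ $\mathcal{M}_{m,\nu}=\{c_{\nu,k}: k\ge 1,\ C_{\nu+m}(c_{\nu,k})=0\}$ is the set of positive zeros common to $C_\nu$ and $C_{\nu+m}$ (possibly empty). The sequence $\{c_{\nu,k_\ell}\}_{\ell=1}^\infty$ is the increasing enumeration of $\{c_{\nu,k}\}_{k=1}^\infty\setminus\mathcal{M}_{m,\nu}$. The sequence $\{\tau_{m,\nu,k}\}_{k=1}^\infty$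 is the increasing enumeration of the set $\{x>0: C_{\nu+m}(x)=0\}\cup\{x>0: R_{m-1,\nu+1}(x)=0\}$ (a set union, each element listed once; the elements of $\mathcal{M}_{m,\nu}$ are not removed from it). *)

theory Defs
  imports "HOL-Analysis.Analysis"
begin

text \<open>Bessel functions of real order, on the positive reals. Using \<^const>\<open>rGamma\<close>, which vanishes at
  the poles of \<^const>\<open>Gamma\<close>, covers the negative integer orders as well.\<close>

definition bessel_J :: "real \<Rightarrow> real \<Rightarrow> real" where
  "bessel_J \<nu> x =
     (\<Sum>k. (-1) ^ k * rGamma (\<nu> + real k + 1) / fact k * (x / 2) powr (2 * real k + \<nu>))"

text \<open>At integer orders the quotient is \<open>0 / 0\<close> and \<open>Y\<close> is the limit of the quotient in the order.\<close>

definition bessel_Y :: "real \<Rightarrow> real \<Rightarrow> real" where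
  "bessel_Y \<nu> x =
     (let q = (\<lambda>\<mu>. (bessel_J \<mu> x * cos (\<mu> * pi) - bessel_J (- \<mu>) x) / sin (\<mu> * pi))
      in if \<nu> \<in> \<int> then Lim (at \<nu>) q else q \<nu>)"

definition cylinder :: "real \<Rightarrow> real \<Rightarrow> real \<Rightarrow> real" where
  "cylinder \<alpha> \<nu> x = cos \<alpha> * bessel_J \<nu> x - sin \<alpha> * bessel_Y \<nu> x"

definition lommel :: "nat \<Rightarrow> real \<Rightarrow> real \<Rightarrow> real" where
  "lommel n \<nu> x =
     (\<Sum>k = 0..n div 2. (-1) ^ k * real ((n - k) choose k)
        * (Gamma (\<nu> + real n - real k) / Gamma (\<nu> + real k))
        * (x / 2) powi (2 * int k - int n))"

text \<open>Sequences are indexed from 0, so the zero usually written with index \<open>k \<ge> 1\<close> is the value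
  at \<open>k - 1\<close>.\<close>

definition increasing_enumeration :: "(nat \<Rightarrow> real) \<Rightarrow> real set \<Rightarrow> bool" where
  "increasing_enumeration f S \<longleftrightarrow> strict_mono f \<and> range f = S"

lemma increasing_enumeration_unique:
  assumes "increasing_enumeration f S" "increasing_enumeration g S"
  shows "f = g"
proof
  have le: "h n \<le> h' n"
    if h: "strict_mono h" "strict_mono h'" "range h = range h'" and IH: "\<And>i. i < n \<Longrightarrow> h i = h' i"
    for h h' :: "nat \<Rightarrow> real" and n
  proof -
    obtain k where k: "h' n = h k" using h(3) by (metis rangeE rangeI)
    have "\<not> k < n" using IH[of k] k strict_mono_less[OF h(2), of k n] by auto
    then show ?thesis using k strict_mono_less_eq[OF h(1), of n k] by simp
  qed
  fix n show "f n = g n"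
  proof (induction n rule: less_induct)
    case (less n)
    then show ?case
      using le[of f g n] le[of g f n] assms
      unfolding increasing_enumeration_def by fastforce
  qed
qed

text \<open>Only meaningful when such an enumeration exists, that is, when
  \<open>increasing_enumeration (enumeration S) S\<close> holds.\<close>

definition enumeration :: "real set \<Rightarrow> nat \<Rightarrow> real" where
  "enumeration S = (THE f. increasing_enumeration f S)"

definition cylinder_zeros :: "real \<Rightarrow> real \<Rightarrow> real set" where
  "cylinder_zeros \<alpha> \<nu> = {x. 0 < x \<and> cylinder \<alpha> \<nu> x = 0}"

definition cylinder_zero :: "real \<Rightarrow> real \<Rightarrow> nat \<Rightarrow> real" where
  "cylinder_zero \<alpha> \<nu> = enumeration (cylinder_zeros \<alpha> \<nu>)"

definition common_zeros :: "real \<Rightarrow> nat \<Rightarrow> real \<Rightarrow> real set" where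
  "common_zeros \<alpha> m \<nu> =
     {cylinder_zero \<alpha> \<nu> k | k. cylinder \<alpha> (\<nu> + real m) (cylinder_zero \<alpha> \<nu> k) = 0}"

definition noncommon_zeros :: "real \<Rightarrow> nat \<Rightarrow> real \<Rightarrow> real set" where
  "noncommon_zeros \<alpha> m \<nu> = range (cylinder_zero \<alpha> \<nu>) - common_zeros \<alpha> m \<nu>"

definition noncommon_zero :: "real \<Rightarrow> nat \<Rightarrow> real \<Rightarrow> nat \<Rightarrow> real" where
  "noncommon_zero \<alpha> m \<nu> = enumeration (noncommon_zeros \<alpha> m \<nu>)"

definition tau_set :: "real \<Rightarrow> nat \<Rightarrow> real \<Rightarrow> real set" where
  "tau_set \<alpha> m \<nu> =
     cylinder_zeros \<alpha> (\<nu> + real m) \<union> {x. 0 < x \<and> lommel (m - 1) (\<nu> + 1) x = 0}"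

definition tau :: "real \<Rightarrow> nat \<Rightarrow> real \<Rightarrow> nat \<Rightarrow> real" where
  "tau \<alpha> m \<nu> = enumeration (tau_set \<alpha> m \<nu>)"

end

theory Submission
  imports Defs "HOL-Complex_Analysis.Cauchy_Integral_Formula" "HOL-Real_Asymp.Real_Asymp"
begin

text \<open>
  Write \<open>m = n + 1\<close>, \<open>P\<close> for the Lommel polynomial \<open>R\<close> of degree \<open>n\<close> and parameter \<open>\<nu> + 1\<close>, and
  \<open>H = C\<^sub>\<nu> P C\<^sub>\<nu>\<^sub>+\<^sub>m\<close>. The zeros of \<open>H\<close> are the noncommon zeros of \<open>C\<^sub>\<nu>\<close> and the points of \<open>\<tau>\<close>. Lommel's
  relations and the Wronskian of consecutive Lommel polynomials show that \<open>H\<close> passes from positive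
  to negative at every noncommon zero and from negative to positive at every point of \<open>\<tau>\<close> (at a
  common zero, \<open>H\<close> has a triple zero). Crossings of the two kinds must alternate, and since \<open>H > 0\<close>
  near \<open>0\<close> the first one is a noncommon zero. There are infinitely many because \<open>C\<^sub>\<nu>\<close> has arbitrarily
  large zeros.
\<close>

section \<open>Power series of the Bessel functions\<close>

text \<open>The factor \<open>P\<close> lets the crossing directions be read off from squares. At a
  noncommon zero of \<open>C \<nu>\<close> one has \<open>C (\<nu> + m) = P * C (\<nu> + 1)\<close>
  and \<open>C \<nu>' = - C (\<nu> + 1)\<close>, hence
  \<open>H' = - (C (\<nu> + m))\<^sup>2\<close>. Where \<open>C (\<nu> + m)\<close> vanishes but
  \<open>P\<close> does not, the relation read from the other end gives
  \<open>H' = (C \<nu>)\<^sup>2\<close>. Where \<open>P\<close> vanishes but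
  \<open>C (\<nu> + m)\<close> does not, \<open>H'\<close> is a positive multiple of
  \<open>(C (\<nu> + m))\<^sup>2\<close>; the Wronskian is needed only there and at common zeros.
  The analytic obstacle is \<open>Y\<close> at integer orders, defined as a limit in the order.
  Resolving it takes the derivative of \<open>J\<close> in the order, hence termwise differentiation
  of the power series in the order and bounds on the derivative of \<open>rGamma\<close>. Beyond
  that, cylinder functions enter only through their derivative rule, their three-term recurrence and
  their sign near \<open>0\<close>; arbitrarily large zeros come from a Riccati equation, not from
  asymptotics at infinity.\<close>

lemma bounded_of_shift_recurrence:
  fixes f g :: "real \<Rightarrow> real"
  assumes cont: "continuous_on UNIV f"
    and rec: "\<And>y. y * f (y + 1) = f y + g y"
    and g: "\<And>y. a \<le> y \<Longrightarrow> \<bar>g y\<bar> \<le> G"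
  obtains M where "\<And>y. a \<le> y \<Longrightarrow> \<bar>f y\<bar> \<le> M"
proof -
  \<comment> \<open>Beyond \<open>N + 1\<close> the recurrence divides by
    \<open>y - 1 \<ge> 2\<close>, so \<open>\<bar>f y\<bar>\<close> is at most the mean of two
    quantities bounded by \<open>M\<close>. A bound on the compact part thus propagates in unit
    steps.\<close>
  define N where "N = max a 2"
  have "compact (f ` {a..N + 1})"
    by (intro compact_continuous_image compact_Icc continuous_on_subset[OF cont]) auto
  then obtain B where B: "\<And>y. y \<in> {a..N + 1} \<Longrightarrow> \<bar>f y\<bar> \<le> B"
    by (metis compact_imp_bounded bounded_real imageI)
  define M where "M = max B G"
  have "\<bar>f y\<bar> \<le> M" if "a \<le> y" "y \<le> N + 1 + real n" for y n
    using that
  proof (induction n arbitrary: y)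
    case 0
    then show ?case using B[of y] by (auto simp: M_def)
  next
    case (Suc n)
    show ?case
    proof (cases "y \<le> N + 1")
      case True
      then show ?thesis using B[of y] Suc.prems by (auto simp: M_def)
    next
      case False
      then have y: "2 \<le> y - 1" "a \<le> y - 1" by (auto simp: N_def)
      have "\<bar>f (y - 1)\<bar> \<le> M" using Suc y by auto
      moreover have "\<bar>g (y - 1)\<bar> \<le> M" using g[OF y(2)] by (auto simp: M_def)
      moreover have "(y - 1) * f y = f (y - 1) + g (y - 1)" using rec[of "y - 1"] by simp
      ultimately have "\<bar>(y - 1) * f y\<bar> \<le> 2 * M" by linarith
      moreover have "2 * \<bar>f y\<bar> \<le> \<bar>(y - 1) * f y\<bar>"
        unfolding abs_mult using y by (intro mult_right_mono) auto
      ultimately show ?thesis by linarith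
    qed
  qed
  moreover have "\<exists>n. y \<le> N + 1 + real n" for y
    by (metis real_arch_simple add.commute diff_le_eq)
  ultimately show thesis using that[of M] by blast
qed

section \<open>The reciprocal Gamma function and its derivative on half-lines\<close>

lemma rGamma_has_real_derivative: "(rGamma has_real_derivative deriv rGamma x) (at (x::real))"
  using has_field_derivative_rGamma DERIV_imp_deriv by metis

lemma deriv_rGamma_plus1: "y * deriv rGamma (y + 1) = deriv rGamma y - rGamma (y + 1)" for y :: real
proof -
  have "((\<lambda>y. y * rGamma (y + 1)) has_real_derivative rGamma (y + 1) + y * deriv rGamma (y + 1)) (at y)"
    using DERIV_mult[OF DERIV_ident DERIV_shift[THEN iffD1, OF rGamma_has_real_derivative[of "y + 1"]]] by (simp add: mult.commute)
  then have "(rGamma has_real_derivative rGamma (y + 1) + y * deriv rGamma (y + 1)) (at y)"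
    by (simp add: rGamma_plus1)
  from DERIV_unique[OF this rGamma_has_real_derivative] show ?thesis by linarith
qed

text \<open>Transfers continuity from the complex derivative, which is holomorphic because the
  complex \<open>rGamma\<close> is entire.\<close>

lemma deriv_rGamma_of_real: "deriv rGamma x = Re (deriv rGamma (complex_of_real x))"
proof -
  have "(rGamma has_field_derivative deriv rGamma (complex_of_real x)) (at (complex_of_real x))"
    using field_differentiable_rGamma DERIV_deriv_iff_field_differentiable by blast
  then have "((\<lambda>y. Re (rGamma (complex_of_real y))) has_real_derivative
      Re (deriv rGamma (complex_of_real x))) (at x)"
    by (intro has_field_derivative_Re has_vector_derivative_real_field)
  then have "(rGamma has_real_derivative Re (deriv rGamma (complex_of_real x))) (at x)"
    by (simp add: rGamma_complex_of_real)
  from DERIV_unique[OF rGamma_has_real_derivative this] show ?thesis .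
qed

lemma continuous_on_deriv_rGamma: "continuous_on UNIV (deriv rGamma :: real \<Rightarrow> real)"
proof -
  have "continuous_on UNIV (deriv rGamma :: complex \<Rightarrow> complex)"
    by (intro holomorphic_on_imp_continuous_on holomorphic_deriv holomorphic_rGamma) auto
  from continuous_on_compose2[OF this continuous_on_of_real_id]
  have "continuous_on UNIV (\<lambda>x. Re (deriv rGamma (complex_of_real x)))"
    by (intro continuous_intros) auto
  then show ?thesis by (simp add: deriv_rGamma_of_real[abs_def])
qed

text \<open>Both functions obey a shift recurrence: the functional equation is homogeneous, and its
  derivative has the already bounded \<open>rGamma\<close> as inhomogeneity.\<close>

lemma rGamma_bounded:
  obtains M where "\<And>y::real. a \<le> y \<Longrightarrow> \<bar>rGamma y\<bar> \<le> M" "\<And>y::real. a \<le> y \<Longrightarrow> \<bar>deriv rGamma y\<bar> \<le> M"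
proof -
  obtain M where M: "\<And>y::real. a \<le> y \<Longrightarrow> \<bar>rGamma y\<bar> \<le> M"
    by (rule bounded_of_shift_recurrence[of rGamma "\<lambda>_. 0" a 0])
       (auto simp: rGamma_plus1 continuous_on_rGamma)
  obtain M' where M': "\<And>y::real. a \<le> y \<Longrightarrow> \<bar>deriv rGamma y\<bar> \<le> M'"
    by (rule bounded_of_shift_recurrence[of "deriv rGamma" "\<lambda>y. - rGamma (y + 1)" a M])
       (auto simp: deriv_rGamma_plus1 continuous_on_deriv_rGamma intro!: M)
  show thesis
    by (rule that[of "max M M'"]) (use M M' in \<open>auto simp: le_max_iff_disj\<close>)
qed

text \<open>\<open>J \<mu> x = (x/2) powr \<mu> * bessel_series \<mu> (x\<^sup>2/4)\<close>; the second series is the derivative of the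
  first in the order \<open>\<mu>\<close>.\<close>

definition bessel_series :: "real \<Rightarrow> real \<Rightarrow> real" where
  "bessel_series \<mu> t = (\<Sum>k. (-1) ^ k * rGamma (\<mu> + real k + 1) / fact k * t ^ k)"

definition bessel_series_order :: "real \<Rightarrow> real \<Rightarrow> real" where
  "bessel_series_order \<mu> t = (\<Sum>k. (-1) ^ k * deriv rGamma (\<mu> + real k + 1) / fact k * t ^ k)"

lemma summable_bounded_exp_series:
  fixes f :: "nat \<Rightarrow> real"
  assumes "\<And>k. \<bar>f k\<bar> \<le> M"
  shows "summable (\<lambda>k. (-1) ^ k * f k / fact k * t ^ k)"
proof (rule summable_comparison_test)
  show "summable (\<lambda>k. M * (inverse (fact k) * \<bar>t\<bar> ^ k))"
    by (intro summable_mult summable_exp)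
  have "norm ((-1) ^ k * f k / fact k * t ^ k) \<le> M * (inverse (fact k) * \<bar>t\<bar> ^ k)" for k
  proof -
    have "norm ((-1) ^ k * f k / fact k * t ^ k) = \<bar>f k\<bar> * (inverse (fact k) * \<bar>t\<bar> ^ k)"
      by (simp add: abs_mult power_abs divide_simps)
    also have "\<dots> \<le> M * (inverse (fact k) * \<bar>t\<bar> ^ k)"
      by (intro mult_right_mono assms) auto
    finally show ?thesis .
  qed
  then show "\<exists>N. \<forall>k\<ge>N. norm ((-1) ^ k * f k / fact k * t ^ k) \<le> M * (inverse (fact k) * \<bar>t\<bar> ^ k)"
    by blast
qed

lemma summable_bessel_series: "summable (\<lambda>k. (-1) ^ k * rGamma (\<mu> + real k + 1) / fact k * t ^ k)"
  and summable_bessel_series_order: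
    "summable (\<lambda>k. (-1) ^ k * deriv rGamma (\<mu> + real k + 1) / fact k * t ^ k)"
proof -
  obtain M where "\<And>y. \<mu> \<le> y \<Longrightarrow> \<bar>rGamma y\<bar> \<le> M" "\<And>y. \<mu> \<le> y \<Longrightarrow> \<bar>deriv rGamma y\<bar> \<le> M"
    by (rule rGamma_bounded[of \<mu>]) blast
  then show "summable (\<lambda>k. (-1) ^ k * rGamma (\<mu> + real k + 1) / fact k * t ^ k)"
    "summable (\<lambda>k. (-1) ^ k * deriv rGamma (\<mu> + real k + 1) / fact k * t ^ k)"
    by (intro summable_bounded_exp_series[of _ M]; simp)+
qed

text \<open>The factor \<open>k + 1\<close> from differentiation cancels against the factorial and
  the index shift moves into the order. Leaving \<open>f\<close> general serves both
  \<open>rGamma\<close> and its derivative.\<close>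

lemma diffs_bessel:
  "diffs (\<lambda>k. (-1) ^ k * f (\<mu> + real k + 1) / fact k) = (\<lambda>k. - ((-1) ^ k * f (\<mu> + 1 + real k + 1) / fact k :: real))"
proof
  fix k
  have "f (\<mu> + real (Suc k) + 1) = f (\<mu> + 1 + real k + 1)" by (simp add: add_ac)
  moreover have "real (Suc k) \<noteq> 0" by simp
  ultimately show "diffs (\<lambda>k. (-1) ^ k * f (\<mu> + real k + 1) / fact k) k =
      - ((-1) ^ k * f (\<mu> + 1 + real k + 1) / fact k :: real)"
    unfolding diffs_def fact_Suc of_nat_mult of_nat_fact by (simp only:) simp
qed

lemma bessel_series_has_real_derivative:
  "(bessel_series \<mu> has_real_derivative - bessel_series (\<mu> + 1) t) (at t)"
  using termdiffs_strong_converges_everywhere[OF summable_bessel_series, of \<mu> t]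
    suminf_minus[OF summable_bessel_series, of "\<mu> + 1" t]
  unfolding diffs_bessel[of rGamma] bessel_series_def[abs_def] by simp

lemma bessel_series_order_has_real_derivative:
  "(bessel_series_order \<mu> has_real_derivative - bessel_series_order (\<mu> + 1) t) (at t)"
  using termdiffs_strong_converges_everywhere[OF summable_bessel_series_order, of \<mu> t]
    suminf_minus[OF summable_bessel_series_order, of "\<mu> + 1" t]
  unfolding diffs_bessel[of "deriv rGamma"] bessel_series_order_def[abs_def] by simp

lemma bessel_series_has_real_derivative_order:
  "((\<lambda>\<mu>. bessel_series \<mu> t) has_real_derivative bessel_series_order \<mu> t) (at \<mu>)"
proof -
  \<comment> \<open>Radius \<open>1\<close> keeps every argument \<open>z + k + 1\<close> at or
    above \<open>\<mu>\<close>, where a single bound \<open>M\<close> on the derivative of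
    \<open>rGamma\<close> holds for all \<open>k\<close>.\<close>
  define S where "S = {\<mu> - 1..\<mu> + 1}"
  define f where "f k z = (-1) ^ k * rGamma (z + real k + 1) / fact k * t ^ k" for k z
  define f' where "f' k z = (-1) ^ k * deriv rGamma (z + real k + 1) / fact k * t ^ k" for k z
  obtain M where M: "\<And>y. \<mu> \<le> y \<Longrightarrow> \<bar>deriv rGamma y\<bar> \<le> M"
    by (rule rGamma_bounded[of \<mu>]) blast
  have "uniform_limit S (\<lambda>n z. \<Sum>k<n. f' k z) (\<lambda>z. \<Sum>k. f' k z) sequentially"
  proof (rule Weierstrass_m_test)
    show "summable (\<lambda>k. M * (inverse (fact k) * \<bar>t\<bar> ^ k))"
      by (intro summable_mult summable_exp)
    fix k z assume z: "z \<in> S"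
    have "norm (f' k z) = \<bar>deriv rGamma (z + real k + 1)\<bar> * (inverse (fact k) * \<bar>t\<bar> ^ k)"
      by (simp add: f'_def abs_mult power_abs divide_simps)
    also have "\<dots> \<le> M * (inverse (fact k) * \<bar>t\<bar> ^ k)"
      by (intro mult_right_mono M) (use z in \<open>auto simp: S_def\<close>)
    finally show "norm (f' k z) \<le> M * (inverse (fact k) * \<bar>t\<bar> ^ k)" .
  qed
  moreover have "(f k has_real_derivative f' k z) (at z within S)" for k z
  proof -
    have "((\<lambda>z. rGamma (z + (real k + 1))) has_real_derivative deriv rGamma (z + (real k + 1))) (at z)"
      by (rule DERIV_shift[THEN iffD1, OF rGamma_has_real_derivative])
    then have "((\<lambda>z. rGamma (z + real k + 1)) has_real_derivative deriv rGamma (z + real k + 1)) (at z)"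
      by (simp add: add.assoc)
    from DERIV_cmult_right[OF DERIV_cdivide[OF DERIV_cmult[OF this]]] show ?thesis
      unfolding f_def f'_def by (rule has_field_derivative_at_within)
  qed
  moreover have "summable (\<lambda>k. f k \<mu>)" unfolding f_def by (rule summable_bessel_series)
  ultimately have "\<exists>g. \<forall>z\<in>S. (\<lambda>k. f k z) sums g z \<and>
      (g has_real_derivative (\<Sum>k. f' k z)) (at z within S)"
    by (intro has_field_derivative_series[of S f f' "\<lambda>z. \<Sum>k. f' k z" \<mu>]) (auto simp: S_def)
  then obtain g where g: "\<And>z. z \<in> S \<Longrightarrow> (\<lambda>k. f k z) sums g z"
      "\<And>z. z \<in> S \<Longrightarrow> (g has_real_derivative (\<Sum>k. f' k z)) (at z within S)"
    by blast
  have gS: "g z = bessel_series z t" if "z \<in> S" for z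
    using g(1)[OF that] by (simp only: bessel_series_def f_def sums_iff)
  have int: "\<mu> \<in> interior S" by (simp add: S_def)
  have "(g has_real_derivative bessel_series_order \<mu> t) (at \<mu>)"
    using g(2)[of \<mu>] int interior_subset at_within_interior[OF int]
    by (auto simp: bessel_series_order_def f'_def S_def)
  moreover have "\<forall>\<^sub>F z in nhds \<mu>. g z = bessel_series z t"
    unfolding eventually_nhds
    by (intro exI[of _ "interior S"])
       (use gS int interior_subset in auto)
  ultimately show ?thesis by (subst DERIV_cong_ev[OF refl _ refl, of _ g]) (auto elim: eventually_mono)
qed

lemma bessel_series_recurrence:
  "bessel_series (\<mu> - 1) t + t * bessel_series (\<mu> + 1) t = \<mu> * bessel_series \<mu> t"
proof -
  define c where "c \<mu> k = (-1) ^ k * rGamma (\<mu> + real k + 1) / fact k * t ^ k" for \<mu> :: real and k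
  have sums: "c \<mu> sums bessel_series \<mu> t" for \<mu>
    using summable_bessel_series by (auto simp: c_def[abs_def] bessel_series_def)
  \<comment> \<open>Multiplication by \<open>t\<close> raises the power by one; \<open>d\<close>
    realigns the second series so that the two can be added termwise.\<close>
  define d where "d k = (if k = 0 then 0 else t * c (\<mu> + 1) (k - 1))" for k
  have "(\<lambda>k. d (Suc k)) sums (t * bessel_series (\<mu> + 1) t)"
    using sums_mult[OF sums] by (simp add: d_def)
  then have "d sums (t * bessel_series (\<mu> + 1) t)"
    by (subst (asm) sums_Suc_iff) (simp add: d_def)
  then have "(\<lambda>k. c (\<mu> - 1) k + d k) sums (bessel_series (\<mu> - 1) t + t * bessel_series (\<mu> + 1) t)"
    by (intro sums_add sums)
  moreover have "c (\<mu> - 1) k + d k = \<mu> * c \<mu> k" for k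
  proof (cases k)
    case 0
    then show ?thesis using rGamma_plus1[of \<mu>] by (simp add: c_def d_def)
  next
    case (Suc n)
    have "rGamma (\<mu> + real n + 1) = (\<mu> + real n + 1) * rGamma (\<mu> + real n + 2)"
      using rGamma_plus1[of "\<mu> + real n + 1"] by (simp add: add.assoc)
    moreover have "\<mu> - 1 + real (Suc n) + 1 = \<mu> + real n + 1" "\<mu> + real (Suc n) + 1 = \<mu> + real n + 2"
      "\<mu> + 1 + real n + 1 = \<mu> + real n + 2" by simp_all
    moreover have "fact (Suc n) = real (Suc n) * fact n" "real (Suc n) = real n + 1" by simp_all
    moreover define G where "G = rGamma (\<mu> + real n + 2)"
    moreover define F where "F = (fact n :: real)"
    moreover have "F \<noteq> 0" "real n + 1 \<noteq> 0" by (simp_all add: F_def)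
    \<comment> \<open>All three coefficients are multiples of \<open>H\<close>, and
      \<open>- (\<mu> + n + 1) + (n + 1) = - \<mu>\<close> closes the comparison.\<close>
    moreover define H where "H = (-1) ^ n * G / ((real n + 1) * F) * t ^ Suc n"
    ultimately have "c (\<mu> - 1) (Suc n) = - ((\<mu> + real n + 1) * H)"
      "t * c (\<mu> + 1) n = (real n + 1) * H"
      "c \<mu> (Suc n) = - H"
      unfolding c_def by (simp_all only: H_def) (simp_all add: mult_ac)
    then show ?thesis by (simp add: Suc d_def) (simp add: algebra_simps)
  qed
  ultimately have "(\<lambda>k. \<mu> * c \<mu> k) sums (bessel_series (\<mu> - 1) t + t * bessel_series (\<mu> + 1) t)"
    by simp
  from sums_unique2[OF this sums_mult[OF sums]] show ?thesis .
qed

lemma bessel_J_eq: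
  assumes "0 < x"
  shows "bessel_J \<mu> x = (x / 2) powr \<mu> * bessel_series \<mu> (x\<^sup>2 / 4)"
proof -
  have "(x / 2) powr (2 * real k + \<mu>) = (x / 2) powr \<mu> * (x\<^sup>2 / 4) ^ k" for k
    using assms powr_realpow[of "x / 2" "2 * k"]
    by (simp add: powr_add power_mult power_divide)
  then have "bessel_J \<mu> x = (\<Sum>k. (x / 2) powr \<mu> *
      ((-1) ^ k * rGamma (\<mu> + real k + 1) / fact k * (x\<^sup>2 / 4) ^ k))"
    by (simp add: bessel_J_def mult_ac)
  also have "\<dots> = (x / 2) powr \<mu> * bessel_series \<mu> (x\<^sup>2 / 4)"
    unfolding bessel_series_def by (rule suminf_mult[OF summable_bessel_series])
  finally show ?thesis .
qed

section \<open>Cylinder functions: derivatives and recurrences\<close>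

text \<open>The derivative of \<open>J\<close> in its order, by the product rule; the values of
  \<open>Y\<close> at integer orders are built from it.\<close>

definition bessel_J_order :: "real \<Rightarrow> real \<Rightarrow> real" where
  "bessel_J_order \<mu> x =
     (x / 2) powr \<mu> * (ln (x / 2) * bessel_series \<mu> (x\<^sup>2 / 4) + bessel_series_order \<mu> (x\<^sup>2 / 4))"

lemma bessel_J_has_real_derivative_order:
  assumes "0 < x"
  shows "((\<lambda>\<mu>. bessel_J \<mu> x) has_real_derivative bessel_J_order \<mu> x) (at \<mu>)"
proof -
  have "((\<lambda>\<mu>. (x / 2) powr \<mu> * bessel_series \<mu> (x\<^sup>2 / 4)) has_real_derivative bessel_J_order \<mu> x) (at \<mu>)"
    using assms unfolding bessel_J_order_def
    by (auto intro!: derivative_eq_intros bessel_series_has_real_derivative_order simp: algebra_simps)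
  then show ?thesis using assms by (simp add: bessel_J_eq)
qed

lemma powr_half_has_real_derivative:
  assumes "0 < x"
  shows "((\<lambda>x. (x / 2) powr \<mu>) has_real_derivative \<mu> / x * (x / 2) powr \<mu>) (at x)"
  using assms by (auto intro!: derivative_eq_intros simp: powr_diff)

lemma has_real_derivative_square_quarter:
  assumes "(f has_real_derivative D) (at (x\<^sup>2 / 4))"
  shows "((\<lambda>x. f (x\<^sup>2 / 4)) has_real_derivative D * (x / 2)) (at x)"
  by (rule DERIV_chain2[where f = f and g = "\<lambda>x. x\<^sup>2 / 4", OF assms]) (auto intro!: derivative_eq_intros)

lemma bessel_J_has_real_derivative:
  assumes "0 < x"
  shows "(bessel_J \<mu> has_real_derivative \<mu> / x * bessel_J \<mu> x - bessel_J (\<mu> + 1) x) (at x)"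
proof -
  note D = DERIV_mult[OF powr_half_has_real_derivative[OF assms, of \<mu>]
      has_real_derivative_square_quarter[OF bessel_series_has_real_derivative[of \<mu>]]]
  have "((\<lambda>x. (x / 2) powr \<mu> * bessel_series \<mu> (x\<^sup>2 / 4)) has_real_derivative
      \<mu> / x * bessel_J \<mu> x - bessel_J (\<mu> + 1) x) (at x)"
    by (rule DERIV_cong[OF D]) (use assms in \<open>simp add: bessel_J_eq powr_add algebra_simps\<close>)
  moreover have "\<forall>\<^sub>F y in nhds x. bessel_J \<mu> y = (y / 2) powr \<mu> * bessel_series \<mu> (y\<^sup>2 / 4)"
    using eventually_nhds_in_open[of "{0<..}" x] assms
    by (auto elim!: eventually_mono simp: bessel_J_eq)
  ultimately show ?thesis by (subst DERIV_cong_ev[OF refl _ refl])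
qed

lemma bessel_J_order_has_real_derivative:
  assumes "0 < x"
  shows "(bessel_J_order \<mu> has_real_derivative
    \<mu> / x * bessel_J_order \<mu> x + bessel_J \<mu> x / x - bessel_J_order (\<mu> + 1) x) (at x)"
proof -
  have L: "((\<lambda>x. ln (x / 2)) has_real_derivative 1 / x) (at x)"
    using assms by (auto intro!: derivative_eq_intros)
  note D = DERIV_mult[OF powr_half_has_real_derivative[OF assms, of \<mu>]
      DERIV_add[OF DERIV_mult[OF L
          has_real_derivative_square_quarter[OF bessel_series_has_real_derivative[of \<mu>]]]
        has_real_derivative_square_quarter[OF bessel_series_order_has_real_derivative[of \<mu>]]]]
  show ?thesis
    unfolding bessel_J_order_def[abs_def]
    by (rule DERIV_cong[OF D]) (use assms in \<open>simp add: bessel_J_eq powr_add algebra_simps\<close>)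
qed

lemma bessel_J_recurrence:
  assumes "0 < x"
  shows "bessel_J (\<mu> - 1) x + bessel_J (\<mu> + 1) x = 2 * \<mu> / x * bessel_J \<mu> x"
proof -
  have p: "(x / 2) powr \<mu> = (x / 2) powr (\<mu> - 1) * (x / 2)"
    "(x / 2) powr (\<mu> + 1) = (x / 2) powr (\<mu> - 1) * (x\<^sup>2 / 4)"
    using assms by (simp_all add: powr_diff powr_add power2_eq_square)
  have "bessel_J (\<mu> - 1) x + bessel_J (\<mu> + 1) x =
      (x / 2) powr (\<mu> - 1) *
      (bessel_series (\<mu> - 1) (x\<^sup>2 / 4) + x\<^sup>2 / 4 * bessel_series (\<mu> + 1) (x\<^sup>2 / 4))"
    unfolding bessel_J_eq[OF assms] p(2) by (simp add: algebra_simps)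
  also have "\<dots> = 2 * \<mu> / x * bessel_J \<mu> x"
    unfolding bessel_J_eq[OF assms] p(1) bessel_series_recurrence using assms by simp
  finally show ?thesis .
qed

text \<open>Differentiate the recurrence for \<open>J\<close> in the order. The term
  \<open>2 / x * bessel_J \<mu> x\<close> comes from the order-dependent coefficient.\<close>

lemma bessel_J_order_recurrence:
  assumes "0 < x"
  shows "bessel_J_order (\<mu> - 1) x + bessel_J_order (\<mu> + 1) x =
    2 / x * bessel_J \<mu> x + 2 * \<mu> / x * bessel_J_order \<mu> x"
proof (rule DERIV_unique)
  note D = bessel_J_has_real_derivative_order[OF assms]
  have "((\<lambda>\<mu>. bessel_J (\<mu> + c) x) has_real_derivative bessel_J_order (\<mu> + c) x) (at \<mu>)" for c
    by (rule DERIV_shift[THEN iffD1, OF D])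
  from DERIV_add[OF this[of "- 1"] this[of 1]]
  show "((\<lambda>\<mu>. bessel_J (\<mu> - 1) x + bessel_J (\<mu> + 1) x) has_real_derivative
      bessel_J_order (\<mu> - 1) x + bessel_J_order (\<mu> + 1) x) (at \<mu>)"
    by simp
  have "((\<lambda>\<mu>. 2 * \<mu> / x * bessel_J \<mu> x) has_real_derivative
      2 / x * bessel_J \<mu> x + 2 * \<mu> / x * bessel_J_order \<mu> x) (at \<mu>)"
    using assms by (auto intro!: derivative_eq_intros D simp: add_divide_distrib)
  then show "((\<lambda>\<mu>. bessel_J (\<mu> - 1) x + bessel_J (\<mu> + 1) x) has_real_derivative
      2 / x * bessel_J \<mu> x + 2 * \<mu> / x * bessel_J_order \<mu> x) (at \<mu>)"
    by (simp add: bessel_J_recurrence[OF assms])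
qed

text \<open>The first \<open>n\<close> coefficients vanish because \<open>rGamma\<close> is zero at
  the nonpositive integers; the rest is the series of order \<open>n\<close>, shifted by
  \<open>n\<close>.\<close>

lemma bessel_series_uminus_of_nat:
  "bessel_series (- real n) t = (-1) ^ n * t ^ n * bessel_series (real n) t"
proof -
  define c where "c k = (-1) ^ k * rGamma (- real n + real k + 1) / fact k * t ^ k" for k
  have "c k = 0" if "k < n" for k
  proof -
    have "- real n + real k + 1 = of_int (int k + 1 - int n)" by simp
    then show ?thesis using that by (simp only: c_def rGamma_of_int) simp
  qed
  then have z: "(\<Sum>k<n. c k) = 0" by simp
  have "c (k + n) = (-1) ^ n * t ^ n * ((-1) ^ k * rGamma (real n + real k + 1) / fact k * t ^ k)" for k
  proof -
    have 1: "- real n + real (k + n) + 1 = of_nat (Suc k)"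
      and 2: "real n + real k + 1 = of_nat (Suc (n + k))" by simp_all
    have rG: "rGamma (real (Suc k)) = inverse (fact k)" for k
      by (simp add: rGamma_inverse_Gamma Gamma_fact)
    show ?thesis
      unfolding c_def 1 2 rG by (simp add: power_add field_simps add_ac)
  qed
  then have "(\<Sum>k. c (k + n)) = (-1) ^ n * t ^ n * bessel_series (real n) t"
    unfolding bessel_series_def by (simp only: suminf_mult[OF summable_bessel_series])
  moreover have "summable c" unfolding c_def by (rule summable_bessel_series)
  ultimately show ?thesis
    using suminf_split_initial_segment[of c n] z unfolding bessel_series_def c_def by simp
qed

lemma bessel_J_uminus_of_nat:
  assumes "0 < x"
  shows "bessel_J (- real n) x = (-1) ^ n * bessel_J (real n) x"
proof -
  define y where "y = x / 2"
  have "0 < y" and x: "x\<^sup>2 / 4 = y * y" using assms by (simp_all add: y_def power2_eq_square)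
  then have "y powr (- real n) * (y * y) ^ n = y powr real n"
    by (simp add: powr_minus powr_realpow power_mult_distrib)
  then have "(x / 2) powr (- real n) * (x\<^sup>2 / 4) ^ n = (x / 2) powr real n"
    by (simp only: x y_def[symmetric])
  then show ?thesis
    using assms by (simp add: bessel_J_eq bessel_series_uminus_of_nat mult.assoc[symmetric])
qed

section \<open>The function \<open>Y\<close> at integer and noninteger orders\<close>

lemma bessel_Y_not_Ints:
  "\<mu> \<notin> \<int> \<Longrightarrow> bessel_Y \<mu> x = (bessel_J \<mu> x * cos (\<mu> * pi) - bessel_J (- \<mu>) x) / sin (\<mu> * pi)"
  by (simp add: bessel_Y_def)

text \<open>L'Hopital's rule in the order: numerator and denominator both vanish at
  \<open>n\<close>, and dividing each by \<open>y - n\<close> turns the limit into a quotient of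
  derivatives.\<close>

lemma bessel_Y_of_nat:
  assumes "0 < x"
  shows "bessel_Y (real n) x = (bessel_J_order (real n) x + (-1) ^ n * bessel_J_order (- real n) x) / pi"
proof -
  define N where "N \<mu> = bessel_J \<mu> x * cos (\<mu> * pi) - bessel_J (- \<mu>) x" for \<mu>
  define N' where "N' = (-1) ^ n * bessel_J_order (real n) x + bessel_J_order (- real n) x"
  note D = bessel_J_has_real_derivative_order[OF assms]
  have N0: "N (real n) = 0" using assms by (simp add: N_def bessel_J_uminus_of_nat)
  have "((\<lambda>\<mu>. bessel_J (- \<mu>) x) has_real_derivative - bessel_J_order (- real n) x) (at (real n))"
    using D[of "- real n"] by (simp add: DERIV_mirror)
  then have "(N has_real_derivative N') (at (real n))"
    unfolding N_def N'_def by (auto intro!: derivative_eq_intros D)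
  then have 1: "((\<lambda>y. N y / (y - real n)) \<longlongrightarrow> N') (at (real n))"
    by (simp add: has_field_derivative_iff N0)
  have "((\<lambda>y. sin (y * pi)) has_real_derivative (-1) ^ n * pi) (at (real n))"
    by (auto intro!: derivative_eq_intros)
  then have 2: "((\<lambda>y. sin (y * pi) / (y - real n)) \<longlongrightarrow> (-1) ^ n * pi) (at (real n))"
    by (simp add: has_field_derivative_iff)
  have "((\<lambda>y. N y / (y - real n) / (sin (y * pi) / (y - real n))) \<longlongrightarrow> N' / ((-1) ^ n * pi)) (at (real n))"
    by (intro tendsto_divide 1 2) simp
  moreover have "\<forall>\<^sub>F y in at (real n). N y / (y - real n) / (sin (y * pi) / (y - real n)) = N y / sin (y * pi)"
    unfolding eventually_at by (intro exI[of _ 1]) auto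
  ultimately have "((\<lambda>y. N y / sin (y * pi)) \<longlongrightarrow> N' / ((-1) ^ n * pi)) (at (real n))"
    by (rule Lim_transform_eventually)
  then have "Lim (at (real n)) (\<lambda>y. N y / sin (y * pi)) = N' / ((-1) ^ n * pi)"
    by (intro tendsto_Lim) auto
  also have "\<dots> = ((-1) ^ n * N') / pi"
    by (cases "even n") (auto simp: field_simps)
  also have "\<dots> = (bessel_J_order (real n) x + (-1) ^ n * bessel_J_order (- real n) x) / pi"
    by (simp add: N'_def algebra_simps flip: power_add power_mult_distrib)
  finally show ?thesis by (simp add: bessel_Y_def N_def)
qed

lemma not_Ints_plus1: "\<mu> \<notin> \<int> \<Longrightarrow> \<mu> + 1 \<notin> \<int>" for \<mu> :: real
  using Ints_diff[of "\<mu> + 1" 1] by auto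

lemma sin_times_pi_nonzero: "\<mu> \<notin> \<int> \<Longrightarrow> sin (\<mu> * pi) \<noteq> 0"
  by (auto simp: sin_zero_iff_int2)

lemma nonneg_Ints_cases:
  assumes "\<mu> \<in> \<int>" "0 \<le> (\<mu>::real)" obtains n where "\<mu> = real n"
  using assms by (metis Nats_cases Nats_altdef2 mem_Collect_eq)

lemma bessel_Y_has_real_derivative:
  assumes "0 < x" "0 \<le> \<mu>"
  shows "(bessel_Y \<mu> has_real_derivative \<mu> / x * bessel_Y \<mu> x - bessel_Y (\<mu> + 1) x) (at x)"
proof (cases "\<mu> \<in> \<int>")
  case False
  let ?s = "sin (\<mu> * pi)" and ?c = "cos (\<mu> * pi)"
  have s: "?s \<noteq> 0" using False by (rule sin_times_pi_nonzero)
  \<comment> \<open>Sine and cosine both change sign under the shift of the order by one, so only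
    the sign of the \<open>J\<close> of negative order flips.\<close>
  have Y1: "bessel_Y (\<mu> + 1) x = (bessel_J (\<mu> + 1) x * ?c + bessel_J (- \<mu> - 1) x) / ?s"
    using s unfolding bessel_Y_not_Ints[OF not_Ints_plus1[OF False]] minus_add_distrib diff_conv_add_uminus
    by (simp add: distrib_right field_simps)
  have "2 * \<mu> / x * bessel_J (- \<mu>) x = - bessel_J (- \<mu> - 1) x - bessel_J (- \<mu> + 1) x"
    using bessel_J_recurrence[OF assms(1), of "- \<mu>"] by (simp add: algebra_simps)
  then have "(bessel_J (- \<mu>) has_real_derivative \<mu> / x * bessel_J (- \<mu>) x + bessel_J (- \<mu> - 1) x) (at x)"
    using bessel_J_has_real_derivative[OF assms(1), of "- \<mu>"] by (elim DERIV_cong) (simp add: algebra_simps)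
  from DERIV_cdivide[OF DERIV_diff[OF DERIV_cmult_right[OF bessel_J_has_real_derivative[OF assms(1), of \<mu>], of ?c] this], of ?s]
  have "((\<lambda>x. (bessel_J \<mu> x * ?c - bessel_J (- \<mu>) x) / ?s) has_real_derivative
      \<mu> / x * bessel_Y \<mu> x - bessel_Y (\<mu> + 1) x) (at x)"
    by (rule DERIV_cong)
       (unfold Y1 bessel_Y_not_Ints[OF False], use s assms in \<open>simp add: field_simps\<close>)
  then show ?thesis by (simp only: bessel_Y_not_Ints[OF False, abs_def])
next
  case True
  then obtain n where n: "\<mu> = real n" using assms nonneg_Ints_cases by blast
  have Y1: "bessel_Y (real n + 1) x =
      (bessel_J_order (real n + 1) x - (-1) ^ n * bessel_J_order (- real n - 1) x) / pi"
  proof -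
    have "real n + 1 = real (Suc n)" "- real n - 1 = - real (Suc n)" by simp_all
    then show ?thesis by (simp only: bessel_Y_of_nat[OF assms(1)]) simp
  qed
  \<comment> \<open>The two \<open>bessel_J / x\<close> terms from differentiating in
    \<open>x\<close> add up to \<open>2 / x * bessel_J (real n) x\<close> and cancel against the
    \<open>2 / x\<close> term of this recurrence.\<close>
  have rec: "bessel_J_order (- real n + 1) x = 2 / x * bessel_J (- real n) x
      - 2 * real n / x * bessel_J_order (- real n) x - bessel_J_order (- real n - 1) x"
    using bessel_J_order_recurrence[OF assms(1), of "- real n"] by simp
  have "((\<lambda>x. (bessel_J_order (real n) x + (-1) ^ n * bessel_J_order (- real n) x) / pi) has_real_derivative
      \<mu> / x * bessel_Y \<mu> x - bessel_Y (\<mu> + 1) x) (at x)"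
    by (rule DERIV_cong[OF DERIV_cdivide[OF DERIV_add[OF
            bessel_J_order_has_real_derivative[OF assms(1), of "real n"]
            DERIV_cmult[OF bessel_J_order_has_real_derivative[OF assms(1), of "- real n"], of "(-1) ^ n"]]]])
       (unfold n Y1 rec bessel_Y_of_nat[OF assms(1)] bessel_J_uminus_of_nat[OF assms(1)],
        use assms in \<open>simp add: field_simps flip: power_add\<close>)
  moreover have "\<forall>\<^sub>F y in nhds x. bessel_Y \<mu> y =
      (bessel_J_order (real n) y + (-1) ^ n * bessel_J_order (- real n) y) / pi"
    using eventually_nhds_in_open[of "{0<..}" x] assms
    by (auto elim!: eventually_mono simp: n bessel_Y_of_nat)
  ultimately show ?thesis by (subst DERIV_cong_ev[OF refl _ refl])
qed

lemma bessel_Y_recurrence: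
  assumes "0 < x" "0 \<le> \<mu>"
  shows "bessel_Y \<mu> x + bessel_Y (\<mu> + 2) x = 2 * (\<mu> + 1) / x * bessel_Y (\<mu> + 1) x"
proof (cases "\<mu> \<in> \<int>")
  case False
  let ?s = "sin (\<mu> * pi)" and ?c = "cos (\<mu> * pi)"
  have s: "?s \<noteq> 0" using False by (rule sin_times_pi_nonzero)
  have F2: "\<mu> + 2 \<notin> \<int>" using not_Ints_plus1[OF not_Ints_plus1[OF False]] by (simp add: add.assoc)
  have Y1: "bessel_Y (\<mu> + 1) x = (bessel_J (\<mu> + 1) x * ?c + bessel_J (- \<mu> - 1) x) / ?s"
    using s unfolding bessel_Y_not_Ints[OF not_Ints_plus1[OF False]] minus_add_distrib diff_conv_add_uminus
    by (simp add: distrib_right field_simps)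
  have Y2: "bessel_Y (\<mu> + 2) x = (bessel_J (\<mu> + 2) x * ?c - bessel_J (- \<mu> - 2) x) / ?s"
    using s unfolding bessel_Y_not_Ints[OF F2] minus_add_distrib diff_conv_add_uminus
    by (simp add: distrib_right field_simps sin_add cos_add)
  have R1: "bessel_J \<mu> x + bessel_J (\<mu> + 2) x = 2 * (\<mu> + 1) / x * bessel_J (\<mu> + 1) x"
    using bessel_J_recurrence[OF assms(1), of "\<mu> + 1"] by (simp add: add.assoc)
  have R2: "bessel_J (- \<mu> - 2) x + bessel_J (- \<mu>) x = - (2 * (\<mu> + 1) / x * bessel_J (- \<mu> - 1) x)"
    using bessel_J_recurrence[OF assms(1), of "- \<mu> - 1"] assms(1) by (simp add: add.assoc field_simps)
  have "bessel_Y \<mu> x + bessel_Y (\<mu> + 2) x =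
      ((bessel_J \<mu> x + bessel_J (\<mu> + 2) x) * ?c - (bessel_J (- \<mu> - 2) x + bessel_J (- \<mu>) x)) / ?s"
    by (simp add: Y2 bessel_Y_not_Ints[OF False] add_divide_distrib diff_divide_distrib algebra_simps)
  also have "\<dots> = 2 * (\<mu> + 1) / x * bessel_Y (\<mu> + 1) x"
    using s assms unfolding R1 R2 Y1 by (simp add: divide_simps) (simp add: algebra_simps)
  finally show ?thesis .
next
  case True
  then obtain n where n: "\<mu> = real n" using assms nonneg_Ints_cases by blast
  have Y1: "bessel_Y (real n + 1) x =
      (bessel_J_order (real n + 1) x - (-1) ^ n * bessel_J_order (- real n - 1) x) / pi"
  proof -
    have "real n + 1 = real (Suc n)" "- real n - 1 = - real (Suc n)" by simp_all
    then show ?thesis by (simp only: bessel_Y_of_nat[OF assms(1)]) simp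
  qed
  have Y2: "bessel_Y (real n + 2) x =
      (bessel_J_order (real n + 2) x + (-1) ^ n * bessel_J_order (- real n - 2) x) / pi"
  proof -
    have "real n + 2 = real (n + 2)" "- real n - 2 = - real (n + 2)" by simp_all
    then show ?thesis by (simp only: bessel_Y_of_nat[OF assms(1)]) simp
  qed
  \<comment> \<open>The minus sign makes the inhomogeneous \<open>2 / x\<close> terms of
    \<open>R1\<close> and \<open>R2\<close> cancel, leaving a homogeneous recurrence for
    \<open>Y\<close>.\<close>
  have J1: "bessel_J (- real n - 1) x = - ((-1) ^ n * bessel_J (real n + 1) x)"
  proof -
    have "real n + 1 = real (Suc n)" "- real n - 1 = - real (Suc n)" by simp_all
    then show ?thesis by (simp only: bessel_J_uminus_of_nat[OF assms(1)]) simp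
  qed
  have R1: "bessel_J_order (real n) x + bessel_J_order (real n + 2) x =
      2 / x * bessel_J (real n + 1) x + 2 * (real n + 1) / x * bessel_J_order (real n + 1) x"
    using bessel_J_order_recurrence[OF assms(1), of "real n + 1"] by (simp add: add.assoc)
  have R2: "bessel_J_order (- real n - 2) x + bessel_J_order (- real n) x =
      2 / x * bessel_J (- real n - 1) x - 2 * (real n + 1) / x * bessel_J_order (- real n - 1) x"
    using bessel_J_order_recurrence[OF assms(1), of "- real n - 1"] assms(1) by (simp add: add.assoc field_simps)
  have pY: "pi * bessel_Y (real n) x = bessel_J_order (real n) x + (-1) ^ n * bessel_J_order (- real n) x"
    "pi * bessel_Y (real n + 1) x = bessel_J_order (real n + 1) x - (-1) ^ n * bessel_J_order (- real n - 1) x"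
    "pi * bessel_Y (real n + 2) x = bessel_J_order (real n + 2) x + (-1) ^ n * bessel_J_order (- real n - 2) x"
    by (simp_all add: Y1 Y2 bessel_Y_of_nat[OF assms(1)])
  have "pi * (bessel_Y \<mu> x + bessel_Y (\<mu> + 2) x) =
      (bessel_J_order (real n) x + bessel_J_order (real n + 2) x)
      + (-1) ^ n * (bessel_J_order (- real n - 2) x + bessel_J_order (- real n) x)"
    unfolding n distrib_left pY by (simp add: algebra_simps)
  also have "\<dots> = 2 * (real n + 1) / x * (pi * bessel_Y (\<mu> + 1) x)"
    unfolding R1 R2 J1 n pY by (cases "even n") (simp_all add: algebra_simps add_divide_distrib diff_divide_distrib)
  finally have "pi * (bessel_Y \<mu> x + bessel_Y (\<mu> + 2) x) = pi * (2 * (\<mu> + 1) / x * bessel_Y (\<mu> + 1) x)"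
    by (simp add: n mult_ac)
  then show ?thesis by (rule mult_left_cancel[THEN iffD1, OF pi_neq_zero])
qed

section \<open>Cylinder functions of nonnegative order\<close>

lemma cylinder_has_real_derivative:
  assumes "0 < x" "0 \<le> \<mu>"
  shows "(cylinder \<alpha> \<mu> has_real_derivative \<mu> / x * cylinder \<alpha> \<mu> x - cylinder \<alpha> (\<mu> + 1) x) (at x)"
  unfolding cylinder_def[abs_def]
  by (rule DERIV_cong[OF DERIV_diff[OF DERIV_cmult[OF bessel_J_has_real_derivative[OF assms(1)]]
          DERIV_cmult[OF bessel_Y_has_real_derivative[OF assms]]]])
     (simp add: algebra_simps)

lemma cylinder_recurrence:
  assumes "0 < x" "0 \<le> \<mu>"
  shows "cylinder \<alpha> (\<mu> + 2) x = 2 * (\<mu> + 1) / x * cylinder \<alpha> (\<mu> + 1) x - cylinder \<alpha> \<mu> x"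
proof -
  have J: "bessel_J (\<mu> + 2) x = 2 * (\<mu> + 1) / x * bessel_J (\<mu> + 1) x - bessel_J \<mu> x"
    using bessel_J_recurrence[OF assms(1), of "\<mu> + 1"] by (simp add: add.assoc)
  have Y: "bessel_Y (\<mu> + 2) x = 2 * (\<mu> + 1) / x * bessel_Y (\<mu> + 1) x - bessel_Y \<mu> x"
    using bessel_Y_recurrence[OF assms] by simp
  show ?thesis unfolding cylinder_def J Y by (simp add: algebra_simps)
qed

text \<open>Eliminating order \<open>\<mu> + 2\<close> by the recurrence makes orders
  \<open>\<mu>\<close> and \<open>\<mu> + 1\<close> a closed first-order linear system.\<close>

lemma cylinder_plus1_has_real_derivative:
  assumes "0 < x" "0 \<le> \<mu>"
  shows "(cylinder \<alpha> (\<mu> + 1) has_real_derivative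
    cylinder \<alpha> \<mu> x - (\<mu> + 1) / x * cylinder \<alpha> (\<mu> + 1) x) (at x)"
  by (rule DERIV_cong[OF cylinder_has_real_derivative[of x "\<mu> + 1" \<alpha>]])
     (use assms cylinder_recurrence[of x \<mu> \<alpha>] in \<open>simp_all add: add.assoc field_simps\<close>)

section \<open>Lommel polynomials\<close>

lemma lommel_0:
  assumes "0 < \<mu>"
  shows "lommel 0 \<mu> x = 1"
  using Gamma_real_pos[OF assms] by (simp add: lommel_def)

lemma lommel_1:
  assumes "0 < \<mu>"
  shows "lommel 1 \<mu> x = 2 * \<mu> / x"
proof -
  have "Gamma (\<mu> + 1) = \<mu> * Gamma \<mu>"
    using assms by (intro Gamma_plus1) (auto elim!: nonpos_Ints_cases)
  then show ?thesis using Gamma_real_pos[OF assms] by (simp add: lommel_def power_int_minus field_simps)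
qed

lemma lommel_recurrence:
  assumes "0 < \<mu>" "0 < x"
  shows "lommel (n + 2) \<mu> x = 2 * (\<mu> + real n + 1) / x * lommel (n + 1) \<mu> x - lommel n \<mu> x"
proof -
  define T where "T n k = (-1) ^ k * real ((n - k) choose k)
      * (Gamma (\<mu> + real n - real k) / Gamma (\<mu> + real k)) * (x / 2) powi (2 * int k - int n)" for n k
  \<comment> \<open>The binomial vanishes for \<open>k\<close> above \<open>n div 2\<close>, so the
    three sums can be given ranges that match after shifting an index.\<close>
  have ext: "lommel n \<mu> x = (\<Sum>k\<le>N. T n k)" if "n div 2 \<le> N" "N \<le> n" for n N
  proof -
    have "(\<Sum>k = 0..n div 2. T n k) = (\<Sum>k\<le>N. T n k)"
      by (rule sum.mono_neutral_left) (use that in \<open>auto simp: T_def\<close>)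
    then show ?thesis by (simp add: lommel_def T_def)
  qed
  have Gpos: "0 < y \<Longrightarrow> Gamma (y + 1) = y * Gamma y" for y :: real
    by (intro Gamma_plus1) (auto elim!: nonpos_Ints_cases)
  have T0: "T (n + 2) 0 = 2 * (\<mu> + real n + 1) / x * T (n + 1) 0"
  proof -
    have "Gamma (\<mu> + real (n + 2)) = (\<mu> + real n + 1) * Gamma (\<mu> + real (n + 1))"
      using Gpos[of "\<mu> + real n + 1"] assms by (simp add: add_ac)
    moreover have "(x / 2) powi (- int (n + 2)) = 2 / x * (x / 2) powi (- int (n + 1))"
      using assms power_int_add[of "x / 2" "- 1" "- int (n + 1)"] by (simp add: power_int_minus)
    ultimately show ?thesis unfolding T_def by (simp add: algebra_simps add_divide_distrib)
  qed
  have TS: "T (n + 2) (Suc k) = 2 * (\<mu> + real n + 1) / x * T (n + 1) (Suc k) - T n k" if "k \<le> n" for k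
  proof -
    define N where "N = n - k"
    define g where "g = Gamma (\<mu> + real N)"
    define h where "h = Gamma (\<mu> + real (Suc k))"
    define p where "p = (x / 2) powi (2 * int k - int n)"
    have n: "n = N + k" using that by (simp add: N_def)
    have h0: "h > 0" and c0: "\<mu> + real k > 0" using assms by (auto simp: h_def intro!: Gamma_real_pos)
    have G1: "Gamma (\<mu> + real N + 1) = (\<mu> + real N) * g"
      unfolding g_def by (rule Gpos) (use assms in auto)
    have h1: "h = (\<mu> + real k) * Gamma (\<mu> + real k)"
      unfolding h_def using Gpos[of "\<mu> + real k"] c0 by (simp add: add_ac)
    then have h2: "1 / Gamma (\<mu> + real k) = (\<mu> + real k) / h"
      using h0 c0 by auto
    have p1: "(x / 2) powi (2 * int (Suc k) - int (n + 1)) = x / 2 * p"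
      using power_int_add[of "x / 2" 1 "2 * int k - int n"] assms by (simp add: p_def algebra_simps)
    have A: "T (n + 2) (Suc k) = - ((-1) ^ k * real (Suc N choose Suc k) * ((\<mu> + real N) * g / h) * p)"
      using G1 by (simp add: T_def n p_def h_def add_ac)
    have B: "2 / x * T (n + 1) (Suc k) = - ((-1) ^ k * real (N choose Suc k) * (g / h) * p)"
    proof -
      have "T (n + 1) (Suc k) = - ((-1) ^ k * real (N choose Suc k) * (g / h) * (x / 2 * p))"
      proof -
        have "n + 1 - Suc k = N" "\<mu> + real (n + 1) - real (Suc k) = \<mu> + real N" by (simp_all add: n)
        then show ?thesis unfolding T_def p1 g_def h_def by (simp only:) simp
      qed
      then show ?thesis using assms by simp
    qed
    have C: "T n k = (-1) ^ k * real (N choose k) * (g * ((\<mu> + real k) / h)) * p"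
      unfolding h2[symmetric] by (simp add: T_def n p_def g_def add_ac)
    \<comment> \<open>Once the common factor \<open>g / h * p\<close> is split off, the coefficient
      identity \<open>K\<close> is Pascal's rule together with this absorption identity.\<close>
    have "real (Suc k) * real (N choose Suc k) = (real N - real k) * real (N choose k)"
    proof (cases "k \<le> N")
      case True
      have "Suc k * (N choose Suc k) = (N - k) * (N choose k)"
        by (simp only: binomial_absorb_comp binomial_absorption)
      then have "real (Suc k * (N choose Suc k)) = real ((N - k) * (N choose k))" by (simp only:)
      then show ?thesis using True by (simp only: of_nat_mult of_nat_diff)
    next
      case False
      then show ?thesis by (simp add: binomial_eq_0)
    qed
    then have K: "(\<mu> + real N) * real (Suc N choose Suc k) =
        (\<mu> + real n + 1) * real (N choose Suc k) + (\<mu> + real k) * real (N choose k)"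
      by (simp add: n algebra_simps)
    have "T (n + 2) (Suc k) = - ((-1) ^ k * (g / h) * p) * ((\<mu> + real N) * real (Suc N choose Suc k))"
      unfolding A by simp
    also have "\<dots> = (\<mu> + real n + 1) * (2 / x * T (n + 1) (Suc k)) - T n k"
      unfolding K B C by (simp add: algebra_simps add_divide_distrib)
    finally show ?thesis by simp
  qed
  have "lommel (n + 2) \<mu> x = (\<Sum>k\<le>Suc n. T (n + 2) k)"
    by (rule ext) auto
  also have "\<dots> = T (n + 2) 0 + (\<Sum>k\<le>n. T (n + 2) (Suc k))"
    by (rule sum.atMost_Suc_shift)
  also have "\<dots> = 2 * (\<mu> + real n + 1) / x * (T (n + 1) 0 + (\<Sum>k\<le>n. T (n + 1) (Suc k))) - (\<Sum>k\<le>n. T n k)"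
  proof -
    have "(\<Sum>k\<le>n. T (n + 2) (Suc k)) = (\<Sum>k\<le>n. 2 * (\<mu> + real n + 1) / x * T (n + 1) (Suc k) - T n k)"
      by (rule sum.cong[OF refl], rule TS) auto
    then show ?thesis unfolding T0 sum_subtractf sum_distrib_left[symmetric] distrib_left
      by linarith
  qed
  also have "T (n + 1) 0 + (\<Sum>k\<le>n. T (n + 1) (Suc k)) = (\<Sum>k\<le>Suc n. T (n + 1) k)"
    by (rule sum.atMost_Suc_shift[symmetric])
  also have "\<dots> = lommel (n + 1) \<mu> x" by (rule ext[symmetric]) auto
  also have "(\<Sum>k\<le>n. T n k) = lommel n \<mu> x" by (rule ext[symmetric]) auto
  finally show ?thesis .
qed

text \<open>For \<open>x \<le> \<mu>\<close> the coefficient of the recurrence is at least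
  \<open>2\<close>, so the values are nondecreasing in the degree, starting from
  \<open>1\<close>.\<close>

lemma lommel_pos:
  assumes "0 < \<mu>" "0 < x" "x \<le> \<mu>"
  shows "0 < lommel n \<mu> x"
proof -
  have "0 < lommel n \<mu> x \<and> lommel n \<mu> x \<le> lommel (n + 1) \<mu> x"
  proof (induction n)
    case 0
    then show ?case using assms by (simp add: lommel_0 lommel_1[simplified])
  next
    case (Suc n)
    have "2 \<le> 2 * (\<mu> + real n + 1) / x" using assms by (simp add: field_simps)
    then have "2 * lommel (n + 1) \<mu> x \<le> 2 * (\<mu> + real n + 1) / x * lommel (n + 1) \<mu> x"
      using Suc by (intro mult_right_mono) auto
    then show ?case using Suc lommel_recurrence[OF assms(1,2), of n] by simp
  qed
  then show ?thesis by simp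
qed

lemma has_real_derivative_const_divide:
  "x \<noteq> 0 \<Longrightarrow> ((\<lambda>x. c / x) has_real_derivative - (c / x\<^sup>2)) (at x)" for c x :: real
  by (auto intro!: derivative_eq_intros simp: power2_eq_square)

text \<open>Existence suffices: all signs involving this derivative will come from the
  Wronskian.\<close>

lemma lommel_has_real_derivative:
  assumes "0 < \<mu>" "0 < x"
  obtains D where "(lommel n \<mu> has_real_derivative D) (at x)"
proof -
  have cong: "(f has_real_derivative D) (at x) \<Longrightarrow> (\<And>y. 0 < y \<Longrightarrow> g y = f y) \<Longrightarrow> (g has_real_derivative D) (at x)"
    for f g :: "real \<Rightarrow> real" and D
    by (rule has_field_derivative_transform_within_open[of f D x "{0<..}"]) (use assms in auto)
  have "(\<exists>D. (lommel n \<mu> has_real_derivative D) (at x)) \<and> (\<exists>D. (lommel (n + 1) \<mu> has_real_derivative D) (at x))"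
  proof (induction n)
    case 0
    have "(lommel 0 \<mu> has_real_derivative 0) (at x)"
      by (rule cong[of "\<lambda>_. 1"]) (auto simp: lommel_0 assms)
    moreover have "(lommel (0 + 1) \<mu> has_real_derivative - (2 * \<mu> / x\<^sup>2)) (at x)"
      by (rule cong[of "\<lambda>x. 2 * \<mu> / x"])
         (use assms lommel_1[OF assms(1)] in \<open>auto intro!: derivative_eq_intros simp: power2_eq_square\<close>)
    ultimately show ?case by blast
  next
    case (Suc n)
    then obtain D D' where D: "(lommel n \<mu> has_real_derivative D) (at x)"
      "(lommel (n + 1) \<mu> has_real_derivative D') (at x)" by blast
    have "((\<lambda>x. 2 * (\<mu> + real n + 1) / x) has_real_derivative - (2 * (\<mu> + real n + 1) / x\<^sup>2)) (at x)"
      using assms by (intro has_real_derivative_const_divide) simp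
    from cong[OF DERIV_diff[OF DERIV_mult[OF this D(2)] D(1)], of "lommel (n + 2) \<mu>"]
      lommel_recurrence[OF assms(1), of _ n]
    have "\<exists>E. (lommel (n + 2) \<mu> has_real_derivative E) (at x)" by blast
    then show ?case using D(2) by auto
  qed
  then show thesis using that by blast
qed

text \<open>The Wronskian \<open>W n\<close> of consecutive polynomials satisfies
  \<open>W (n + 1) = W n - 2 (\<mu> + n + 1) / x\<^sup>2 * (lommel (n + 1))\<^sup>2\<close>.\<close>

lemma lommel_wronskian:
  assumes "0 < \<mu>" "0 < x"
    and "(lommel n \<mu> has_real_derivative D) (at x)"
    and "(lommel (n + 1) \<mu> has_real_derivative D') (at x)"
  shows "D' * lommel n \<mu> x - lommel (n + 1) \<mu> x * D < 0"
  using assms(3,4)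
proof (induction n arbitrary: D D')
  case 0
  have 1: "(lommel 0 \<mu> has_real_derivative 0) (at x)"
    by (rule has_field_derivative_transform_within_open[of "\<lambda>_. 1" _ _ "{0<..}"])
       (use assms in \<open>auto simp: lommel_0\<close>)
  have "((\<lambda>x. 2 * \<mu> / x) has_real_derivative - (2 * \<mu> / x\<^sup>2)) (at x)"
    using assms by (auto intro!: derivative_eq_intros simp: power2_eq_square)
  then have 2: "(lommel (0 + 1) \<mu> has_real_derivative - (2 * \<mu> / x\<^sup>2)) (at x)"
    by (rule has_field_derivative_transform_within_open[of _ _ _ "{0<..}"])
       (use assms lommel_1[OF assms(1)] in auto)
  have "D = 0" "D' = - (2 * \<mu> / x\<^sup>2)"
    using DERIV_unique[OF 0(1) 1] DERIV_unique[OF 0(2) 2] by auto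
  then show ?case using assms by (simp add: lommel_0)
next
  case (Suc n)
  obtain E where E: "(lommel n \<mu> has_real_derivative E) (at x)"
    using lommel_has_real_derivative[OF assms(1,2)] .
  have D: "(lommel (n + 1) \<mu> has_real_derivative D) (at x)" using Suc.prems by simp
  define a where "a = 2 * (\<mu> + real n + 1) / x"
  define b where "b = 2 * (\<mu> + real n + 1) / x\<^sup>2"
  have "((\<lambda>x. 2 * (\<mu> + real n + 1) / x) has_real_derivative - b) (at x)"
    using assms unfolding b_def by (intro has_real_derivative_const_divide) simp
  from DERIV_diff[OF DERIV_mult[OF this D] E]
  have "(lommel (n + 2) \<mu> has_real_derivative - b * lommel (n + 1) \<mu> x + D * a - E) (at x)"
    unfolding a_def
    by (rule has_field_derivative_transform_within_open[of _ _ _ "{0<..}"])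
       (use assms lommel_recurrence[OF assms(1), of _ n] in auto)
  from DERIV_unique[OF this] Suc.prems(2)
  have D': "D' = - b * lommel (n + 1) \<mu> x + D * a - E" by simp
  have "D' * lommel (n + 1) \<mu> x - lommel (n + 2) \<mu> x * D =
      - (b * (lommel (n + 1) \<mu> x)\<^sup>2) + (D * lommel n \<mu> x - lommel (n + 1) \<mu> x * E)"
    unfolding D' lommel_recurrence[OF assms(1,2)] a_def[symmetric]
    by (simp add: algebra_simps power2_eq_square)
  moreover have "0 \<le> b * (lommel (n + 1) \<mu> x)\<^sup>2"
    using assms by (simp add: b_def)
  ultimately show ?case using Suc.IH[OF E D] by simp
qed

section \<open>Cylinder functions near the origin\<close>

lemma rGamma_reflection_real: "rGamma x * rGamma (1 - x) = sin (pi * x) / pi" for x :: real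
proof -
  have "complex_of_real (rGamma x * rGamma (1 - x)) = complex_of_real (sin (pi * x) / pi)"
    using rGamma_reflection_complex[of "complex_of_real x"]
    by (simp add: rGamma_complex_of_real[symmetric] sin_of_real[symmetric])
  then show ?thesis by (simp only: of_real_eq_iff)
qed

lemma tendsto_bessel_series_at_0:
  "((\<lambda>x. bessel_series \<mu> (x\<^sup>2 / 4)) \<longlongrightarrow> rGamma (\<mu> + 1)) (at_right 0)"
  "((\<lambda>x. bessel_series_order \<mu> (x\<^sup>2 / 4)) \<longlongrightarrow> deriv rGamma (\<mu> + 1)) (at_right 0)"
proof -
  have t: "((\<lambda>x::real. x\<^sup>2 / 4) \<longlongrightarrow> 0) (at_right 0)"
    by (auto intro!: tendsto_eq_intros)
  have "bessel_series \<mu> 0 = rGamma (\<mu> + 1)" "bessel_series_order \<mu> 0 = deriv rGamma (\<mu> + 1)"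
    using powser_zero[of "\<lambda>k. (-1) ^ k * rGamma (\<mu> + real k + 1) / fact k"]
      powser_zero[of "\<lambda>k. (-1) ^ k * deriv rGamma (\<mu> + real k + 1) / fact k"]
    by (simp_all add: bessel_series_def bessel_series_order_def)
  then show "((\<lambda>x. bessel_series \<mu> (x\<^sup>2 / 4)) \<longlongrightarrow> rGamma (\<mu> + 1)) (at_right 0)"
    "((\<lambda>x. bessel_series_order \<mu> (x\<^sup>2 / 4)) \<longlongrightarrow> deriv rGamma (\<mu> + 1)) (at_right 0)"
    using isCont_tendsto_compose[OF DERIV_isCont[OF bessel_series_has_real_derivative[of \<mu> 0]] t]
      isCont_tendsto_compose[OF DERIV_isCont[OF bessel_series_order_has_real_derivative[of \<mu> 0]] t]
    by simp_all
qed

lemma tendsto_powr_half_at_0: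
  assumes "0 < \<mu>"
  shows "((\<lambda>x::real. (x / 2) powr \<mu> * (x / 2) powr \<mu>) \<longlongrightarrow> 0) (at_right 0)"
    "((\<lambda>x::real. (x / 2) powr \<mu> * (x / 2) powr \<mu> * ln (x / 2)) \<longlongrightarrow> 0) (at_right 0)"
  using assms by (real_asymp, real_asymp)

text \<open>The part of order \<open>- \<mu>\<close> dominates. At noninteger orders the reflection
  formula evaluates its leading coefficient; at \<open>\<mu> = n\<close> that coefficient is the
  derivative of \<open>rGamma\<close> at \<open>1 - n\<close>, which is
  \<open>(-1) ^ (n - 1) * fact (n - 1)\<close>.\<close>

lemma tendsto_bessel_Y_at_0:
  assumes "0 < \<mu>"
  shows "((\<lambda>x::real. (x / 2) powr \<mu> * bessel_Y \<mu> x) \<longlongrightarrow> - Gamma \<mu> / pi) (at_right 0)"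
proof (cases "\<mu> \<in> \<int>")
  case False
  let ?s = "sin (\<mu> * pi)" and ?c = "cos (\<mu> * pi)"
  have s: "?s \<noteq> 0" using False by (rule sin_times_pi_nonzero)
  have "((\<lambda>x. ((x / 2) powr \<mu> * (x / 2) powr \<mu> * bessel_series \<mu> (x\<^sup>2 / 4) * ?c
      - bessel_series (- \<mu>) (x\<^sup>2 / 4)) / ?s) \<longlongrightarrow> (0 * rGamma (\<mu> + 1) * ?c - rGamma (- \<mu> + 1)) / ?s) (at_right 0)"
    by (intro tendsto_intros tendsto_powr_half_at_0 tendsto_bessel_series_at_0 assms s)
  also have "(0 * rGamma (\<mu> + 1) * ?c - rGamma (- \<mu> + 1)) / ?s = - Gamma \<mu> / pi"
    using rGamma_reflection_real[of \<mu>] s Gamma_real_pos[OF assms]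
    by (simp add: rGamma_inverse_Gamma[of \<mu>] field_simps)
  finally show ?thesis
  proof (rule Lim_transform_eventually)
    have "\<forall>\<^sub>F x in at_right 0. 0 < (x::real)" by (simp add: eventually_at_right_less)
    then show "\<forall>\<^sub>F x in at_right 0. ((x / 2) powr \<mu> * (x / 2) powr \<mu> * bessel_series \<mu> (x\<^sup>2 / 4) * ?c
        - bessel_series (- \<mu>) (x\<^sup>2 / 4)) / ?s = (x / 2) powr \<mu> * bessel_Y \<mu> x"
    proof eventually_elim
      case (elim x)
      then have "(x / 2) powr \<mu> * (x / 2) powr (- \<mu>) = 1" by (simp add: powr_add[symmetric])
      then have "(x / 2) powr \<mu> * bessel_J (- \<mu>) x = bessel_series (- \<mu>) (x\<^sup>2 / 4)"
        unfolding bessel_J_eq[OF elim] mult.assoc[symmetric] by simp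
      then show ?case
        unfolding bessel_Y_not_Ints[OF False] bessel_J_eq[OF elim, of \<mu>]
        by (simp add: right_diff_distrib mult_ac)
    qed
  qed
next
  case True
  then obtain n where n: "\<mu> = real n" using assms nonneg_Ints_cases[of \<mu>] by auto
  then have n0: "0 < n" using assms by simp
  define p where "p x = (x / 2) powr \<mu>" for x :: real
  have "((\<lambda>x. (2 * (p x * p x * ln (x / 2) * bessel_series \<mu> (x\<^sup>2 / 4))
      + p x * p x * bessel_series_order \<mu> (x\<^sup>2 / 4)
      + (-1) ^ n * bessel_series_order (- real n) (x\<^sup>2 / 4)) / pi) \<longlongrightarrow>
      (2 * (0 * rGamma (\<mu> + 1)) + 0 * deriv rGamma (\<mu> + 1) + (-1) ^ n * deriv rGamma (- real n + 1)) / pi) (at_right 0)"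
    unfolding p_def
    by (intro tendsto_intros tendsto_powr_half_at_0 tendsto_bessel_series_at_0 assms) simp
  also have "(2 * (0 * rGamma (\<mu> + 1)) + 0 * deriv rGamma (\<mu> + 1) + (-1) ^ n * deriv rGamma (- real n + 1)) / pi
      = - Gamma \<mu> / pi"
  proof -
    have "deriv rGamma (- real (n - 1)) = (-1) ^ (n - 1) * fact (n - 1)"
      by (rule DERIV_imp_deriv[OF has_field_derivative_rGamma_nonpos_int])
    moreover have "- real (n - 1) = - real n + 1" using n0 by (simp add: of_nat_diff)
    ultimately have "deriv rGamma (- real n + 1) = (-1) ^ (n - 1) * fact (n - 1)" by simp
    moreover have "Gamma (real n) = fact (n - 1)"
      using Gamma_fact[of "n - 1", where ?'a = real] n0 by (simp add: of_nat_diff)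
    ultimately show ?thesis using n0 by (cases n) (simp_all add: n flip: power_add)
  qed
  finally show ?thesis
  proof (rule Lim_transform_eventually)
    have "\<forall>\<^sub>F x in at_right 0. 0 < (x::real)" by (simp add: eventually_at_right_less)
    then show "\<forall>\<^sub>F x in at_right 0. (2 * (p x * p x * ln (x / 2) * bessel_series \<mu> (x\<^sup>2 / 4))
      + p x * p x * bessel_series_order \<mu> (x\<^sup>2 / 4)
      + (-1) ^ n * bessel_series_order (- real n) (x\<^sup>2 / 4)) / pi = (x / 2) powr \<mu> * bessel_Y \<mu> x"
    proof eventually_elim
      case (elim x)
      define L where "L = ln (x / 2)"
      define t where "t = x\<^sup>2 / 4"
      define q where "q = (x / 2) powr (- real n)"
      have pq: "p x * q = 1" using elim by (simp add: p_def q_def n powr_add[symmetric])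
      \<comment> \<open>In the order derivative at \<open>- n\<close>, \<open>ln (x / 2)\<close>
        multiplies this series with total weight \<open>p x * q = 1\<close>. The relation between
        orders \<open>n\<close> and \<open>- n\<close> exposes a factor \<open>p x * p x\<close>,
        which beats the logarithm.\<close>
      have "q * bessel_series (- real n) t = (-1) ^ n * (p x * bessel_series \<mu> t)"
        using bessel_J_uminus_of_nat[OF elim, of n]
        by (simp only: bessel_J_eq[OF elim] p_def q_def n t_def)
      then have "p x * (q * bessel_series (- real n) t) = (-1) ^ n * (p x * p x * bessel_series \<mu> t)"
        by simp
      then have s: "bessel_series (- real n) t = (-1) ^ n * (p x * p x * bessel_series \<mu> t)"
        using pq by (simp add: mult.assoc[symmetric])
      have "pi * bessel_Y \<mu> x = bessel_J_order (real n) x + (-1) ^ n * bessel_J_order (- real n) x"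
        by (simp add: n bessel_Y_of_nat[OF elim])
      then have "pi * (p x * bessel_Y \<mu> x) =
          p x * (bessel_J_order (real n) x + (-1) ^ n * bessel_J_order (- real n) x)"
        by simp
      also have "\<dots> = p x * (p x * (L * bessel_series \<mu> t + bessel_series_order \<mu> t))
          + (-1) ^ n * ((p x * q) * (L * bessel_series (- real n) t + bessel_series_order (- real n) t))"
        unfolding bessel_J_order_def L_def[symmetric] t_def[symmetric] q_def[symmetric] p_def n
        by (simp add: algebra_simps)
      also have "\<dots> = 2 * (p x * p x * L * bessel_series \<mu> t) + p x * p x * bessel_series_order \<mu> t
          + (-1) ^ n * bessel_series_order (- real n) t"
        unfolding pq s by (cases "even n") (simp_all add: algebra_simps)
      finally show ?case
        unfolding p_def[symmetric] L_def[symmetric] t_def[symmetric] by (simp add: field_simps)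
    qed
  qed
qed

text \<open>The range of \<open>\<alpha>\<close> fixes the sign: for \<open>\<alpha> = 0\<close>
  only the positive \<open>J\<close> remains, and otherwise \<open>sin \<alpha> > 0\<close> while
  \<open>Y\<close> tends to minus infinity and dominates.\<close>

lemma eventually_cylinder_pos_at_0:
  assumes "0 < \<mu>" "0 \<le> \<alpha>" "\<alpha> < pi"
  shows "\<forall>\<^sub>F x in at_right 0. 0 < cylinder \<alpha> \<mu> x"
proof -
  have pos: "\<forall>\<^sub>F x in at_right 0. 0 < (x::real)" by (simp add: eventually_at_right_less)
  have G: "0 < Gamma \<mu>" "0 < Gamma (\<mu> + 1)" using assms by (auto intro: Gamma_real_pos)
  show ?thesis
  proof (cases "\<alpha> = 0")
    case True
    have "0 < rGamma (\<mu> + 1)" using G by (simp add: rGamma_inverse_Gamma)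
    from order_tendstoD(1)[OF tendsto_bessel_series_at_0(1) this] pos show ?thesis
      by eventually_elim (simp add: True cylinder_def bessel_J_eq)
  next
    case False
    then have s: "0 < sin \<alpha>" using assms by (intro sin_gt_zero) auto
    have "((\<lambda>x. cos \<alpha> * ((x / 2) powr \<mu> * (x / 2) powr \<mu> * bessel_series \<mu> (x\<^sup>2 / 4))
        - sin \<alpha> * ((x / 2) powr \<mu> * bessel_Y \<mu> x)) \<longlongrightarrow>
        cos \<alpha> * (0 * rGamma (\<mu> + 1)) - sin \<alpha> * (- Gamma \<mu> / pi)) (at_right 0)"
      by (intro tendsto_intros tendsto_powr_half_at_0 tendsto_bessel_series_at_0 tendsto_bessel_Y_at_0 assms)
    moreover have "0 < cos \<alpha> * (0 * rGamma (\<mu> + 1)) - sin \<alpha> * (- Gamma \<mu> / pi)"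
      using s G by simp
    ultimately have "\<forall>\<^sub>F x in at_right 0. 0 < cos \<alpha> * ((x / 2) powr \<mu> * (x / 2) powr \<mu> * bessel_series \<mu> (x\<^sup>2 / 4))
        - sin \<alpha> * ((x / 2) powr \<mu> * bessel_Y \<mu> x)"
      by (rule order_tendstoD(1))
    with pos show ?thesis
    proof eventually_elim
      case (elim x)
      have "cos \<alpha> * ((x / 2) powr \<mu> * (x / 2) powr \<mu> * bessel_series \<mu> (x\<^sup>2 / 4))
        - sin \<alpha> * ((x / 2) powr \<mu> * bessel_Y \<mu> x) = (x / 2) powr \<mu> * cylinder \<alpha> \<mu> x"
        unfolding cylinder_def bessel_J_eq[OF elim(1)] by (simp add: algebra_simps)
      then show ?case using elim by (simp add: zero_less_mult_iff)
    qed
  qed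
qed

section \<open>Alternating crossings\<close>

lemma enumeration_eqI: "increasing_enumeration f S \<Longrightarrow> enumeration S = f"
  unfolding enumeration_def by (rule the_equality) (auto dest: increasing_enumeration_unique)

text \<open>Iterate the map \<open>g\<close> to the next element of \<open>S\<close>, starting from
  \<open>0\<close>. An element that is missed would lie above all iterates, contradicting finiteness
  below it.\<close>

lemma ex_increasing_enumeration:
  assumes fin: "\<And>b. finite {x \<in> S. x \<le> b}" and unbounded: "\<And>b. \<exists>x\<in>S. b < x"
    and pos: "\<And>x. x \<in> S \<Longrightarrow> 0 < x"
  obtains f where "increasing_enumeration f S"
proof -
  have "\<exists>x\<in>S. b < x \<and> (\<forall>y\<in>S. b < y \<longrightarrow> x \<le> y)" for b
  proof -
    obtain u where u: "u \<in> S" "b < u" using unbounded by blast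
    define A where "A = {x \<in> S. x \<le> u} \<inter> {b<..}"
    have A: "finite A" "u \<in> A" using fin u by (auto simp: A_def)
    then have "Min A \<in> A" using Min_in by blast
    moreover have "Min A \<le> y" if "y \<in> S" "b < y" for y
    proof (cases "y \<le> u")
      case True
      then show ?thesis using that A by (intro Min_le) (auto simp: A_def)
    next
      case False
      then show ?thesis using Min_le[OF A] by simp
    qed
    ultimately show ?thesis by (auto simp: A_def)
  qed
  then obtain g where g: "\<And>b. g b \<in> S" "\<And>b. b < g b" "\<And>b y. y \<in> S \<Longrightarrow> b < y \<Longrightarrow> g b \<le> y"
    by metis
  define f where "f n = (g ^^ Suc n) 0" for n
  have f: "f 0 = g 0" "f (Suc n) = g (f n)" for n by (simp_all add: f_def)
  have mono: "strict_mono f" by (simp add: strict_mono_Suc_iff f g(2))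
  have fS: "f n \<in> S" for n by (cases n) (simp_all add: f g(1))
  have "x \<in> range f" if x: "x \<in> S" for x
  proof (rule ccontr)
    assume nx: "x \<notin> range f"
    have "f n < x" for n
    proof (induction n)
      case 0
      have "f 0 \<le> x" using g(3)[OF x pos[OF x]] by (simp add: f)
      then show ?case using nx by (metis order_le_less rangeI)
    next
      case (Suc n)
      have "f (Suc n) \<le> x" using g(3)[OF x Suc] by (simp add: f)
      then show ?case using nx by (metis order_le_less rangeI)
    qed
    then have "range f \<subseteq> {y \<in> S. y \<le> x}" using fS by (auto intro: less_imp_le)
    then have "finite (range f)" using fin finite_subset by blast
    then show False using range_inj_infinite strict_mono_imp_inj_on[OF mono] by blast
  qed
  then have "range f = S" using fS by auto
  then show thesis using that mono unfolding increasing_enumeration_def by blast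
qed

text \<open>Signs are assumed only next to the endpoints, because \<open>H\<close> vanishes at zeros
  serving as endpoints and the left one may be the origin, outside its domain of continuity.\<close>

lemma no_sign_change_without_zero:
  fixes H :: "real \<Rightarrow> real"
  assumes "a < b" and cont: "continuous_on {a<..<b} H" and nz: "\<And>x. a < x \<Longrightarrow> x < b \<Longrightarrow> H x \<noteq> 0"
    and pos: "\<forall>\<^sub>F x in at_right a. 0 < H x" and neg: "\<forall>\<^sub>F x in at_left b. H x < 0"
  shows False
proof -
  have "\<forall>\<^sub>F x in at_right a. 0 < H x \<and> x \<in> {a<..<b}"
    by (intro eventually_conj pos eventually_at_right_real assms)
  from eventually_happens'[OF trivial_limit_at_right_real this]
  obtain x where x: "0 < H x" "x \<in> {a<..<b}" by blast
  have "\<forall>\<^sub>F x in at_left b. H x < 0 \<and> x \<in> {a<..<b}"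
    by (intro eventually_conj neg eventually_at_left_real assms)
  from eventually_happens'[OF trivial_limit_at_left_real this]
  obtain y where y: "H y < 0" "y \<in> {a<..<b}" by blast
  have "connected (H ` {a<..<b})" by (rule connected_continuous_image[OF cont]) simp
  from connectedD_interval[OF this, of "H y" "H x" 0] x y have "0 \<in> H ` {a<..<b}" by simp
  then show False using nz by auto
qed

text \<open>Two neighbouring crossings of the same kind would enclose a sign change without a zero.
  Finiteness is returned as well, since it also yields an enumeration of all zeros of
  \<open>C \<nu>\<close>, common ones included.\<close>

lemma crossings_alternate:
  fixes H :: "real \<Rightarrow> real"
  assumes cont: "continuous_on {0<..} H"
    and pos: "\<And>x. x \<in> N \<union> T \<Longrightarrow> 0 < x"
    and zeros: "\<And>x. 0 < x \<Longrightarrow> H x = 0 \<longleftrightarrow> x \<in> N \<union> T"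
    and at0: "\<forall>\<^sub>F x in at_right 0. 0 < H x"
    and N: "\<And>x. x \<in> N \<Longrightarrow> \<forall>\<^sub>F y in at_left x. 0 < H y" "\<And>x. x \<in> N \<Longrightarrow> \<forall>\<^sub>F y in at_right x. H y < 0"
    and T: "\<And>x. x \<in> T \<Longrightarrow> \<forall>\<^sub>F y in at_left x. H y < 0" "\<And>x. x \<in> T \<Longrightarrow> \<forall>\<^sub>F y in at_right x. 0 < H y"
    and unbounded: "\<And>b. \<exists>x\<in>N \<union> T. b < x"
  obtains z where "strict_mono z" "increasing_enumeration (\<lambda>l. z (2 * l)) N"
    "increasing_enumeration (\<lambda>l. z (2 * l + 1)) T"
    "\<And>b. finite {x \<in> N \<union> T. x \<le> b}"
proof -
  have disj: "x \<notin> T" if "x \<in> N" for x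
  proof
    assume "x \<in> T"
    have "\<forall>\<^sub>F y in at_left x. False"
      using N(1)[OF that] T(1)[OF \<open>x \<in> T\<close>] by eventually_elim simp
    then show False by (simp add: trivial_limit_at_left_real)
  qed
  have fin: "finite {x \<in> N \<union> T. x \<le> b}" for b
  proof (rule ccontr)
    assume inf: "infinite {x \<in> N \<union> T. x \<le> b}"
    \<comment> \<open>Positivity near \<open>0\<close> confines the zeros up to \<open>b\<close> to
      a compact interval, and an accumulation point there is excluded: at a crossing
      \<open>H\<close> is nonzero on both sides, elsewhere by continuity.\<close>
    obtain e where e: "0 < e" "\<And>x. 0 < x \<Longrightarrow> x < e \<Longrightarrow> 0 < H x"
      using at0 unfolding eventually_at_right_field by auto
    have "e \<le> x" if "x \<in> N \<union> T" for x
      using e(2)[of x] zeros[OF pos[OF that]] that pos[OF that] by force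
    then have "{x \<in> N \<union> T. x \<le> b} \<subseteq> {e..b}" by auto
    with inf obtain x where x: "x \<in> {e..b}" "x islimpt {x \<in> N \<union> T. x \<le> b}"
      using compact_eq_Bolzano_Weierstrass[THEN iffD1, OF compact_Icc[of e b]] by meson
    have x0: "0 < x" using x e by auto
    have "\<forall>\<^sub>F y in at x. H y \<noteq> 0"
    proof (cases "x \<in> N \<union> T")
      case True
      then consider "x \<in> N" | "x \<in> T" by blast
      then show ?thesis
      proof cases
        case 1
        show ?thesis unfolding eventually_at_split
          using N(1)[OF 1] N(2)[OF 1] by (auto elim: eventually_mono)
      next
        case 2
        show ?thesis unfolding eventually_at_split
          using T(1)[OF 2] T(2)[OF 2] by (auto elim: eventually_mono)
      qed
    next
      case False
      have "isCont H x" using cont x0 by (simp add: continuous_on_eq_continuous_at)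
      then show ?thesis using False zeros[OF x0]
        by (intro tendsto_imp_eventually_ne[of H "H x"]) (auto simp: isCont_def)
    qed
    then have "\<forall>\<^sub>F y in at x. y \<notin> {x \<in> N \<union> T. x \<le> b}"
      by eventually_elim (use pos zeros in blast)
    then show False using x(2) by (simp add: islimpt_iff_eventually)
  qed
  obtain z where z: "increasing_enumeration z (N \<union> T)"
    by (rule ex_increasing_enumeration[OF fin unbounded pos])
  have mono: "strict_mono z" and range: "range z = N \<union> T"
    using z by (auto simp: increasing_enumeration_def)
  have zpos: "0 < z i" for i using pos range by blast
  have zS: "z i \<in> N \<union> T" for i using range by blast
  have gap: "H x \<noteq> 0" if "z i < x" "x < z (Suc i)" for x i
  proof
    assume "H x = 0"
    then have "x \<in> range z" using zeros that zpos[of i] range by auto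
    then obtain j where "x = z j" by blast
    then show False using that strict_mono_less[OF mono] by auto
  qed
  have gap0: "H x \<noteq> 0" if "0 < x" "x < z 0" for x
  proof
    assume "H x = 0"
    then have "x \<in> range z" using zeros that range by auto
    then obtain j where "x = z j" by blast
    then show False using that strict_mono_less[OF mono] by auto
  qed
  have lt: "z i < z (Suc i)" for i using mono by (simp add: strict_mono_Suc_iff)
  have c: "continuous_on {a<..<b} H" if "0 \<le> a" for a b
    by (rule continuous_on_subset[OF cont]) (use that in auto)
  have alt: "if even i then z i \<in> N else z i \<in> T" for i
  proof (induction i)
    case 0
    have "z 0 \<notin> T"
    proof
      assume "z 0 \<in> T"
      from no_sign_change_without_zero[OF zpos c gap0 at0 T(1)[OF this]] show False by simp
    qed
    then show ?case using zS[of 0] by simp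
  next
    case (Suc i)
    show ?case
    proof (cases "even i")
      case True
      then have zi: "z i \<in> N" using Suc by simp
      have "z (Suc i) \<notin> N"
      proof
        assume "z (Suc i) \<in> N"
        from N(2)[OF zi] N(1)[OF this] show False
          using no_sign_change_without_zero[OF lt, of i "\<lambda>x. - H x"] gap[of i]
            continuous_on_minus[OF c[of "z i"]] zpos[of i] by (simp add: less_imp_le)
      qed
      then show ?thesis using True zS[of "Suc i"] by simp
    next
      case False
      then have zi: "z i \<in> T" using Suc by simp
      have "z (Suc i) \<notin> T"
      proof
        assume "z (Suc i) \<in> T"
        from T(2)[OF zi] T(1)[OF this] show False
          using no_sign_change_without_zero[OF lt, of i H] gap[of i]
            c[of "z i"] zpos[of i] by (simp add: less_imp_le)
      qed
      then show ?thesis using False zS[of "Suc i"] by simp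
    qed
  qed
  have ev: "z (2 * l) \<in> N" and od: "z (2 * l + 1) \<in> T" for l
    using alt[of "2 * l"] alt[of "2 * l + 1"] by simp_all
  have "x \<in> range (\<lambda>l. z (2 * l))" if "x \<in> N" for x
  proof -
    have "x \<in> range z" using that range by simp
    then obtain i where i: "x = z i" by blast
    have "even i"
    proof (rule ccontr)
      assume "odd i"
      then show False using alt[of i] disj[OF that] i by simp
    qed
    then obtain l where "i = 2 * l" by (elim evenE)
    then show ?thesis using i by blast
  qed
  moreover have "x \<in> range (\<lambda>l. z (2 * l + 1))" if "x \<in> T" for x
  proof -
    have "x \<in> range z" using that range by simp
    then obtain i where i: "x = z i" by blast
    have "odd i"
    proof
      assume "even i"
      then show False using alt[of i] disj that i by simp
    qed
    then obtain l where "i = 2 * l + 1" by (elim oddE)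
    then show ?thesis using i by blast
  qed
  ultimately have "range (\<lambda>l. z (2 * l)) = N" "range (\<lambda>l. z (2 * l + 1)) = T"
    using ev od by (intro equalityI subsetI; auto)+
  moreover have "strict_mono (\<lambda>l. z (2 * l))" "strict_mono (\<lambda>l. z (2 * l + 1))"
    by (auto intro!: strict_monoI strict_monoD[OF mono])
  ultimately show thesis by (intro that[OF mono _ _ fin]) (simp_all add: increasing_enumeration_def)
qed

text \<open>The factor \<open>D\<close> avoids a case split on its sign and lets the statements for
  several factors be multiplied together at a common zero.\<close>

lemma sign_near_simple_zero:
  fixes f :: "real \<Rightarrow> real"
  assumes "(f has_real_derivative D) (at x)" "f x = 0" "D \<noteq> 0"
  shows "\<forall>\<^sub>F y in at_left x. D * f y < 0" "\<forall>\<^sub>F y in at_right x. 0 < D * f y"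
proof -
  have D: "((\<lambda>y. D * f y) has_real_derivative D * D) (at x)" using assms by (intro DERIV_cmult)
  have p: "0 < D * D" using assms by (metis not_real_square_gt_zero)
  obtain d where d: "0 < d" "\<And>h. 0 < h \<Longrightarrow> h < d \<Longrightarrow> D * f (x - h) < D * f x"
    using DERIV_pos_inc_left[OF D p] by blast
  have "D * f y < 0" if "x - d < y" "y < x" for y
    using d(2)[of "x - y"] that assms by simp
  then show "\<forall>\<^sub>F y in at_left x. D * f y < 0"
    unfolding eventually_at_left_field using d(1) by (intro exI[of _ "x - d"]) auto
  obtain d where d: "0 < d" "\<And>h. 0 < h \<Longrightarrow> h < d \<Longrightarrow> D * f x < D * f (x + h)"
    using DERIV_pos_inc_right[OF D p] by blast
  have "0 < D * f y" if "x < y" "y < x + d" for y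
    using d(2)[of "y - x"] that assms by simp
  then show "\<forall>\<^sub>F y in at_right x. 0 < D * f y"
    unfolding eventually_at_right_field using d(1) by (intro exI[of _ "x + d"]) auto
qed

section \<open>Zeros of cylinder functions\<close>

text \<open>The weight in \<open>G\<close> makes \<open>G\<close> nondecreasing, so a common zero would force \<open>C\<close> to vanish on
  all of \<open>(0, x)\<close>.\<close>

lemma cylinder_not_both_zero:
  assumes "0 < \<nu>" "0 \<le> \<alpha>" "\<alpha> < pi" "0 < x"
  shows "cylinder \<alpha> \<nu> x \<noteq> 0 \<or> cylinder \<alpha> (\<nu> + 1) x \<noteq> 0"
proof (rule ccontr)
  assume "\<not> ?thesis"
  then have z: "cylinder \<alpha> \<nu> x = 0" "cylinder \<alpha> (\<nu> + 1) x = 0" by auto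
  \<comment> \<open>With exponent \<open>2 * \<nu> + 2\<close> the squares of
    \<open>C (\<nu> + 1)\<close> cancel in the derivative; the mixed terms cancel for any
    exponent.\<close>
  define G where "G y = y powr (2 * \<nu> + 2) * ((cylinder \<alpha> \<nu> y)\<^sup>2 + (cylinder \<alpha> (\<nu> + 1) y)\<^sup>2)" for y
  have G': "(G has_real_derivative y powr (2 * \<nu> + 1) * ((4 * \<nu> + 2) * (cylinder \<alpha> \<nu> y)\<^sup>2)) (at y)" if "0 < y" for y
  proof -
    define a where "a = cylinder \<alpha> \<nu> y"
    define b where "b = cylinder \<alpha> (\<nu> + 1) y"
    have p: "y powr (2 * \<nu> + 2) = y powr (2 * \<nu> + 1) * y"
      using that powr_add[of y "2 * \<nu> + 1" 1] by (simp add: add.assoc)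
    have p': "((\<lambda>y. y powr (2 * \<nu> + 2)) has_real_derivative (2 * \<nu> + 2) * y powr (2 * \<nu> + 1)) (at y)"
      using has_real_derivative_powr[OF that, of "2 * \<nu> + 2"] by (simp add: add.commute)
    have ca: "(cylinder \<alpha> \<nu> has_real_derivative \<nu> / y * a - b) (at y)"
      and cb: "(cylinder \<alpha> (\<nu> + 1) has_real_derivative a - (\<nu> + 1) / y * b) (at y)"
      unfolding a_def b_def
      using that assms cylinder_has_real_derivative[of y \<nu> \<alpha>] cylinder_plus1_has_real_derivative[of y \<nu> \<alpha>]
      by simp_all
    show ?thesis
      unfolding G_def
      by (rule DERIV_cong[OF DERIV_mult[OF p' DERIV_add[OF DERIV_power[OF ca, of 2] DERIV_power[OF cb, of 2]]]])
         (unfold a_def[symmetric] b_def[symmetric] p, use that in \<open>simp add: field_simps power2_eq_square\<close>)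
  qed
  have "\<forall>\<^sub>F y in at_right 0. 0 < cylinder \<alpha> \<nu> y \<and> y \<in> {0<..<x}"
    by (intro eventually_conj eventually_cylinder_pos_at_0 eventually_at_right_real assms)
  from eventually_happens'[OF trivial_limit_at_right_real this]
  obtain y where y: "0 < cylinder \<alpha> \<nu> y" "0 < y" "y < x" by auto
  have "G y \<le> G x"
    by (rule DERIV_nonneg_imp_nondecreasing) (use y assms in \<open>auto intro!: exI G'\<close>)
  moreover have "G x = 0" by (simp add: G_def z)
  moreover have "0 < G y" unfolding G_def using y by (intro mult_pos_pos add_pos_nonneg) auto
  ultimately show False by simp
qed

text \<open>If \<open>C\<close> had no zeros beyond \<open>b\<close>, then \<open>D = C (\<nu> + 1) / C \<nu>\<close> would solve the Riccati equation
  \<open>D' = 1 - (2 \<nu> + 1) / x * D + D\<^sup>2\<close> there, so \<open>(arctan D)' \<ge> 1 / 2\<close> once \<open>x \<ge> 2 \<nu> + 1\<close>.\<close>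

lemma cylinder_zeros_unbounded:
  assumes "0 < \<nu>"
  shows "\<exists>x\<in>cylinder_zeros \<alpha> \<nu>. b < x"
proof (rule ccontr)
  assume no: "\<not> ?thesis"
  define r where "r = max (b + 1) (2 * \<nu> + 1)"
  have nz: "cylinder \<alpha> \<nu> x \<noteq> 0" if "r \<le> x" for x
    using no that assms by (auto simp: cylinder_zeros_def r_def)
  define D where "D x = cylinder \<alpha> (\<nu> + 1) x / cylinder \<alpha> \<nu> x" for x
  define G where "G x = arctan (D x) - x / 2" for x
  \<comment> \<open>Over a length of \<open>2 * pi\<close> a slope of at least \<open>1 / 2\<close>
    forces \<open>arctan\<close> to gain \<open>pi\<close>, which its open range does not
    allow.\<close>
  define s where "s = r + 2 * pi"
  have "G r \<le> G s"
  proof (rule DERIV_nonneg_imp_nondecreasing[of r s G])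
    show "r \<le> s" by (simp add: s_def)
    fix x assume x: "r \<le> x" "x \<le> s"
    have x0: "0 < x" "2 * \<nu> + 1 \<le> x" using x assms by (auto simp: r_def)
    define k where "k = (2 * \<nu> + 1) / x"
    have k: "0 \<le> k" "k \<le> 1" using x0 assms by (auto simp: k_def)
    define a where "a = cylinder \<alpha> \<nu> x"
    define c where "c = cylinder \<alpha> (\<nu> + 1) x"
    have a: "a \<noteq> 0" using nz x by (simp add: a_def)
    have ca: "(cylinder \<alpha> \<nu> has_real_derivative \<nu> / x * a - c) (at x)"
      and cc: "(cylinder \<alpha> (\<nu> + 1) has_real_derivative a - (\<nu> + 1) / x * c) (at x)"
      unfolding a_def c_def
      using x0 assms cylinder_has_real_derivative[of x \<nu> \<alpha>] cylinder_plus1_has_real_derivative[of x \<nu> \<alpha>]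
      by simp_all
    have "(D has_real_derivative 1 - k * (c / a) + (c / a)\<^sup>2) (at x)"
      unfolding D_def
      by (rule DERIV_cong[OF DERIV_divide[OF cc ca]])
         (unfold a_def[symmetric] c_def[symmetric] k_def, use a x0 in \<open>simp_all add: field_simps power2_eq_square\<close>)
    then have "(D has_real_derivative 1 - k * D x + (D x)\<^sup>2) (at x)" by (simp add: D_def a_def c_def)
    have A: "((\<lambda>x. arctan (D x)) has_real_derivative
        inverse (1 + (D x)\<^sup>2) * (1 - k * D x + (D x)\<^sup>2)) (at x)"
      by (rule DERIV_chain2[where f = arctan and g = D]) (rule DERIV_arctan, fact)
    have B: "((\<lambda>x. x / 2) has_real_derivative 1 / 2) (at x)"
      by (auto intro!: derivative_eq_intros)
    have "(G has_real_derivative (1 - k * D x + (D x)\<^sup>2) / (1 + (D x)\<^sup>2) - 1 / 2) (at x)"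
      unfolding G_def
      by (rule DERIV_cong[OF DERIV_diff[OF A B]]) (simp add: inverse_eq_divide)
    moreover have "0 \<le> (1 - k * D x + (D x)\<^sup>2) / (1 + (D x)\<^sup>2) - 1 / 2"
    proof -
      \<comment> \<open>This expands to \<open>1 - 2 * k * D x + (D x)\<^sup>2\<close>, the
        difference of the two sides of the next inequality.\<close>
      have "0 \<le> (D x - k)\<^sup>2 + (1 - k) * (1 + k)" using k by simp
      then have "1 + (D x)\<^sup>2 \<le> 2 * (1 - k * D x + (D x)\<^sup>2)" by (simp add: power2_eq_square algebra_simps)
      moreover have "0 < 1 + (D x)\<^sup>2" by (rule add_pos_nonneg) auto
      ultimately show ?thesis by (simp add: pos_le_divide_eq)
    qed
    ultimately show "\<exists>y. (G has_real_derivative y) (at x) \<and> 0 \<le> y" by blast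
  qed
  then have "arctan (D r) + pi \<le> arctan (D s)" by (simp add: G_def s_def add_divide_distrib)
  then show False using arctan_lbound[of "D r"] arctan_ubound[of "D s"] by simp
qed

section \<open>Interlacing\<close>

lemma cylinder_recurrence_of_nat:
  assumes "0 < \<nu>" "0 < x"
  shows "cylinder \<alpha> (\<nu> + real (n + 2)) x =
    2 * (\<nu> + real n + 1) / x * cylinder \<alpha> (\<nu> + real (n + 1)) x - cylinder \<alpha> (\<nu> + real n) x"
proof -
  have "\<nu> + real (n + 2) = \<nu> + real n + 2" "\<nu> + real (n + 1) = \<nu> + real n + 1" by simp_all
  then show ?thesis using cylinder_recurrence[of x "\<nu> + real n" \<alpha>] assms by (simp only:)
qed

lemma lommel_recurrence_plus1:
  assumes "0 < \<nu>" "0 < x"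
  shows "lommel (n + 2) (\<nu> + 1) x =
    2 * (\<nu> + real (n + 1) + 1) / x * lommel (n + 1) (\<nu> + 1) x - lommel n (\<nu> + 1) x"
proof -
  have "\<nu> + 1 + real n + 1 = \<nu> + real (n + 1) + 1" by simp
  then show ?thesis using lommel_recurrence[of "\<nu> + 1" x n] assms by (simp only:)
qed

text \<open>Lommel's relation read backwards: both sides satisfy the same three-term recurrence.\<close>

lemma cylinder_eq_lommel:
  assumes "0 < \<nu>" "0 < x"
  shows "cylinder \<alpha> \<nu> x = lommel (n + 1) (\<nu> + 1) x * cylinder \<alpha> (\<nu> + real (n + 1)) x
    - lommel n (\<nu> + 1) x * cylinder \<alpha> (\<nu> + real (n + 2)) x"
proof (induction n)
  case 0
  show ?case
    using cylinder_recurrence_of_nat[OF assms, of \<alpha> 0] assms lommel_1[of "\<nu> + 1" x]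
    by (simp add: lommel_0 add.commute)
next
  case (Suc n)
  define a where "a = 2 * (\<nu> + real (n + 1) + 1) / x"
  have C: "cylinder \<alpha> (\<nu> + real (Suc n + 2)) x =
      a * cylinder \<alpha> (\<nu> + real (Suc n + 1)) x - cylinder \<alpha> (\<nu> + real (n + 1)) x"
    using cylinder_recurrence_of_nat[OF assms, of \<alpha> "n + 1"] by (simp add: a_def)
  have L: "lommel (Suc n + 1) (\<nu> + 1) x = a * lommel (Suc n) (\<nu> + 1) x - lommel n (\<nu> + 1) x"
    using lommel_recurrence_plus1[OF assms, of n] by (simp add: a_def)
  have "cylinder \<alpha> \<nu> x = lommel (Suc n) (\<nu> + 1) x * cylinder \<alpha> (\<nu> + real (n + 1)) x
      - lommel n (\<nu> + 1) x * cylinder \<alpha> (\<nu> + real (Suc n + 1)) x"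
    using Suc.IH by simp
  then show ?case unfolding C L by (simp only: left_diff_distrib right_diff_distrib) simp
qed

text \<open>In the forward Lommel relation the other term is a multiple of \<open>C \<nu>\<close>,
  of parameter \<open>\<nu> + 2\<close>, and drops at a zero. The induction carries two consecutive
  degrees for the three-term recurrence.\<close>

lemma cylinder_eq_lommel_at_zero:
  assumes "0 < \<nu>" "0 < x" "cylinder \<alpha> \<nu> x = 0"
  shows "cylinder \<alpha> (\<nu> + real (n + 1)) x = lommel n (\<nu> + 1) x * cylinder \<alpha> (\<nu> + 1) x"
proof -
  have "cylinder \<alpha> (\<nu> + real (n + 1)) x = lommel n (\<nu> + 1) x * cylinder \<alpha> (\<nu> + 1) x \<and>
      cylinder \<alpha> (\<nu> + real (n + 2)) x = lommel (n + 1) (\<nu> + 1) x * cylinder \<alpha> (\<nu> + 1) x"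
  proof (induction n)
    case 0
    show ?case
      using cylinder_recurrence_of_nat[OF assms(1,2), of \<alpha> 0] assms lommel_1[of "\<nu> + 1" x]
      by (simp add: lommel_0 add.commute)
  next
    case (Suc n)
    define a where "a = 2 * (\<nu> + real (n + 1) + 1) / x"
    have C: "cylinder \<alpha> (\<nu> + real (Suc n + 2)) x =
        a * cylinder \<alpha> (\<nu> + real (n + 2)) x - cylinder \<alpha> (\<nu> + real (n + 1)) x"
      using cylinder_recurrence_of_nat[OF assms(1,2), of \<alpha> "n + 1"] by (simp add: a_def)
    have L: "lommel (Suc n + 1) (\<nu> + 1) x = a * lommel (n + 1) (\<nu> + 1) x - lommel n (\<nu> + 1) x"
      using lommel_recurrence_plus1[OF assms(1,2), of n] by (simp add: a_def)
    have "cylinder \<alpha> (\<nu> + real (Suc n + 2)) x = lommel (Suc n + 1) (\<nu> + 1) x * cylinder \<alpha> (\<nu> + 1) x"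
      unfolding C L conjunct1[OF Suc.IH] conjunct2[OF Suc.IH] by (simp only: left_diff_distrib mult.assoc)
    then show ?case using Suc.IH by simp
  qed
  then show ?thesis by blast
qed

lemma cylinder_eq_lommel_at_upper_zero:
  assumes "0 < \<nu>" "0 < x" "cylinder \<alpha> (\<nu> + real (n + 1)) x = 0"
  shows "cylinder \<alpha> \<nu> x = lommel n (\<nu> + 1) x * cylinder \<alpha> (\<nu> + real n) x"
proof (cases n)
  case 0
  then show ?thesis using assms by (simp add: lommel_0)
next
  case (Suc k)
  then show ?thesis using cylinder_eq_lommel[OF assms(1,2), of \<alpha> k] assms(3) by simp
qed

text \<open>The witness \<open>q\<close> is the Lommel polynomial of degree \<open>n - 1\<close>;
  here \<open>n > 0\<close> because degree \<open>0\<close> gives the constant \<open>1\<close>. At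
  a zero of the polynomial the Wronskian reduces to \<open>D * q\<close>.\<close>

lemma lommel_zero_cases:
  assumes "0 < \<nu>" "0 < x" "lommel n (\<nu> + 1) x = 0" "(lommel n (\<nu> + 1) has_real_derivative D) (at x)"
  obtains q where "D * q < 0" "cylinder \<alpha> \<nu> x = - q * cylinder \<alpha> (\<nu> + real (n + 1)) x"
    "cylinder \<alpha> \<nu> x = 0 \<Longrightarrow> cylinder \<alpha> (\<nu> + real n) x = q * cylinder \<alpha> (\<nu> + 1) x"
proof -
  obtain k where n: "n = Suc k" using assms lommel_0[of "\<nu> + 1" x] by (cases n) auto
  obtain E where E: "(lommel k (\<nu> + 1) has_real_derivative E) (at x)"
    using lommel_has_real_derivative[of "\<nu> + 1" x] assms by auto
  show thesis
  proof (rule that[of "lommel k (\<nu> + 1) x"])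
    show "D * lommel k (\<nu> + 1) x < 0"
      using lommel_wronskian[OF _ assms(2) E, of D] assms by (simp add: n)
    show "cylinder \<alpha> \<nu> x = - lommel k (\<nu> + 1) x * cylinder \<alpha> (\<nu> + real (n + 1)) x"
      using cylinder_eq_lommel[OF assms(1,2), of \<alpha> k] assms(3) by (simp add: n)
    show "cylinder \<alpha> (\<nu> + real n) x = lommel k (\<nu> + 1) x * cylinder \<alpha> (\<nu> + 1) x" if "cylinder \<alpha> \<nu> x = 0"
      using cylinder_eq_lommel_at_zero[OF assms(1,2) that, of k] by (simp add: n)
  qed
qed

theorem theorem4p2:
  fixes \<alpha> \<nu> :: real and m :: nat
  assumes "0 \<le> \<alpha>" and "\<alpha> < pi" and "0 < \<nu>" and "1 \<le> m"
  shows "increasing_enumeration (cylinder_zero \<alpha> \<nu>) (cylinder_zeros \<alpha> \<nu>)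
    \<and> increasing_enumeration (noncommon_zero \<alpha> m \<nu>) (noncommon_zeros \<alpha> m \<nu>)
    \<and> increasing_enumeration (tau \<alpha> m \<nu>) (tau_set \<alpha> m \<nu>)
    \<and> 0 < noncommon_zero \<alpha> m \<nu> 0
    \<and> (\<forall>l. noncommon_zero \<alpha> m \<nu> l < tau \<alpha> m \<nu> l
          \<and> tau \<alpha> m \<nu> l < noncommon_zero \<alpha> m \<nu> (Suc l))"
proof -
  obtain n where m: "m = n + 1" using assms(4) by (metis add.commute le_add_diff_inverse)
  have mn: "\<nu> + real m = \<nu> + real n + 1" by (simp add: m)
  note \<nu> = assms(3)
  let ?C = "cylinder \<alpha>" and ?P = "lommel n (\<nu> + 1)"
  define N where "N = {x. 0 < x \<and> ?C \<nu> x = 0 \<and> ?C (\<nu> + real m) x \<noteq> 0}"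
  define H where "H x = ?C \<nu> x * ?P x * ?C (\<nu> + real m) x" for x
  have tau: "tau_set \<alpha> m \<nu> = {x. 0 < x \<and> (?C (\<nu> + real m) x = 0 \<or> ?P x = 0)}"
    by (auto simp: tau_set_def cylinder_zeros_def m)
  have nb: "?C \<nu> x \<noteq> 0 \<or> ?C (\<nu> + 1) x \<noteq> 0" if "0 < x" for x
    by (rule cylinder_not_both_zero[OF \<nu> assms(1,2) that])
  have dC: "(?C \<nu> has_real_derivative - ?C (\<nu> + 1) x) (at x)" if "0 < x" "?C \<nu> x = 0" for x
    using cylinder_has_real_derivative[of x \<nu> \<alpha>] that \<nu> by simp
  have dCm: "(?C (\<nu> + real m) has_real_derivative ?C (\<nu> + real n) x) (at x)"
    if "0 < x" "?C (\<nu> + real m) x = 0" for x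
    using cylinder_plus1_has_real_derivative[of x "\<nu> + real n" \<alpha>] that \<nu> unfolding mn by simp
  have cont: "isCont (?C \<mu>) x" if "0 < x" "0 \<le> \<mu>" for x \<mu>
    using cylinder_has_real_derivative[OF that] DERIV_isCont by blast
  have "\<exists>D. (?P has_real_derivative D) (at x)" if "0 < x" for x
    by (rule lommel_has_real_derivative[of "\<nu> + 1" x n]) (use \<nu> that in auto)
  then obtain dP where dP: "(?P has_real_derivative dP x) (at x)" if "0 < x" for x
    by metis
  have contH: "continuous_on {0<..} H"
    unfolding H_def continuous_on_eq_continuous_at[OF open_greaterThan]
    using \<nu> cont DERIV_isCont[OF dP] by (auto intro!: continuous_mult)
  have dH: "(H has_real_derivative
      ((c * ?P x + p * ?C \<nu> x) * ?C (\<nu> + real m) x + d * (?C \<nu> x * ?P x))) (at x)"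
    if "(?C \<nu> has_real_derivative c) (at x)" "(?P has_real_derivative p) (at x)"
      "(?C (\<nu> + real m) has_real_derivative d) (at x)" for x c p d
    unfolding H_def by (rule DERIV_mult[OF DERIV_mult[OF that(1,2)] that(3)])
  have ex: "\<exists>d. (?C \<mu> has_real_derivative d) (at x)" if "0 < x" "0 \<le> \<mu>" for x \<mu>
    using cylinder_has_real_derivative[OF that] by blast
  have down: "\<exists>D<0. (H has_real_derivative D) (at x) \<and> H x = 0" if "x \<in> N" for x
  proof -
    have x: "0 < x" "?C \<nu> x = 0" "?C (\<nu> + real m) x \<noteq> 0" using that by (auto simp: N_def)
    obtain d where d: "(?C (\<nu> + real m) has_real_derivative d) (at x)" using ex[of x "\<nu> + real m"] x \<nu> by auto
    have e: "?C (\<nu> + real m) x = ?P x * ?C (\<nu> + 1) x"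
      using cylinder_eq_lommel_at_zero[OF \<nu> x(1,2)] by (simp add: m)
    then have "0 < (?P x * ?C (\<nu> + 1) x)\<^sup>2" using x(3) by simp
    then show ?thesis
      using dH[OF dC[OF x(1,2)] dP[OF x(1)] d] x(2) unfolding e
      by (intro exI[of _ "- ((?P x * ?C (\<nu> + 1) x)\<^sup>2)"]) (simp add: H_def power2_eq_square mult_ac)
  qed
  have up: "(\<forall>\<^sub>F y in at_left x. H y < 0) \<and> (\<forall>\<^sub>F y in at_right x. 0 < H y)" if "x \<in> tau_set \<alpha> m \<nu>" for x
  proof -
    have x: "0 < x" and xt: "?C (\<nu> + real m) x = 0 \<or> ?P x = 0" using that by (auto simp: tau)
    have simple: ?thesis if "(H has_real_derivative D) (at x)" "0 < D" "H x = 0" for D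
      using sign_near_simple_zero[OF that(1,3)] that(2) by (simp add: zero_less_mult_iff mult_less_0_iff)
    consider (upper) "?C (\<nu> + real m) x = 0" "?P x \<noteq> 0" | (lommel) "?P x = 0" "?C (\<nu> + real m) x \<noteq> 0"
      | (common) "?P x = 0" "?C (\<nu> + real m) x = 0"
      using xt by blast
    then show ?thesis
    proof cases
      case upper
      obtain c where c: "(?C \<nu> has_real_derivative c) (at x)" using ex[of x \<nu>] x \<nu> by auto
      have e: "?C \<nu> x = ?P x * ?C (\<nu> + real n) x"
        using cylinder_eq_lommel_at_upper_zero[OF \<nu> x, of \<alpha> n] upper by (simp add: m)
      \<comment> \<open>Since \<open>P\<close> is nonzero here, a zero of \<open>C \<nu>\<close>
        would force \<open>C (\<nu> + 1)\<close> to vanish too.\<close>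
      have "?C \<nu> x \<noteq> 0"
      proof
        assume z: "?C \<nu> x = 0"
        then have "?C (\<nu> + 1) x = 0"
          using cylinder_eq_lommel_at_zero[OF \<nu> x z, of n] upper by (simp add: m)
        then show False using nb[OF x] z by simp
      qed
      moreover have "?C (\<nu> + real n) x * (?C \<nu> x * ?P x) = (?C \<nu> x)\<^sup>2"
        by (simp add: e power2_eq_square mult_ac)
      ultimately have "0 < ?C (\<nu> + real n) x * (?C \<nu> x * ?P x)" by simp
      then show ?thesis
        using simple[OF dH[OF c dP[OF x] dCm[OF x upper(1)]]] upper by (simp add: H_def)
    next
      case lommel
      obtain c where c: "(?C \<nu> has_real_derivative c) (at x)" using ex[of x \<nu>] x \<nu> by auto
      obtain d where d: "(?C (\<nu> + real m) has_real_derivative d) (at x)" using ex[of x "\<nu> + real m"] x \<nu> by auto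
      obtain q where q: "dP x * q < 0" "?C \<nu> x = - q * ?C (\<nu> + real m) x"
        using lommel_zero_cases[OF \<nu> x lommel(1) dP[OF x], of \<alpha>] unfolding m by metis
      have "dP x * ?C \<nu> x * ?C (\<nu> + real m) x = - (dP x * q) * (?C (\<nu> + real m) x)\<^sup>2"
        by (simp add: q(2) power2_eq_square mult_ac)
      moreover have "0 < - (dP x * q) * (?C (\<nu> + real m) x)\<^sup>2"
        using q(1) lommel(2) by (intro mult_pos_pos) auto
      ultimately show ?thesis
        using simple[OF dH[OF c dP[OF x] d]] lommel by (simp add: H_def)
    next
      case common
      obtain q where q: "dP x * q < 0" "?C \<nu> x = - q * ?C (\<nu> + real m) x"
        "?C \<nu> x = 0 \<Longrightarrow> ?C (\<nu> + real n) x = q * ?C (\<nu> + 1) x"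
        using lommel_zero_cases[OF \<nu> x common(1) dP[OF x], of \<alpha>] unfolding m by metis
      have z: "?C \<nu> x = 0" using q(2) common by simp
      then have c1: "?C (\<nu> + 1) x \<noteq> 0" using nb[OF x] by simp
      \<comment> \<open>\<open>D\<close> is the product of the derivatives of the three factors, so
        \<open>H\<close> behaves like \<open>D * (y - x) ^ 3\<close>. Multiplying by
        \<open>D\<close> pairs each factor with its own derivative.\<close>
      define D where "D = - ?C (\<nu> + 1) x * dP x * ?C (\<nu> + real n) x"
      have "D = - (dP x * q) * (?C (\<nu> + 1) x)\<^sup>2"
        by (simp add: D_def q(3)[OF z] power2_eq_square mult_ac)
      moreover have "0 < - (dP x * q) * (?C (\<nu> + 1) x)\<^sup>2"
        using q(1) c1 by (intro mult_pos_pos) auto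
      ultimately have D: "0 < D" by simp
      have nz: "- ?C (\<nu> + 1) x \<noteq> 0" "dP x \<noteq> 0" "?C (\<nu> + real n) x \<noteq> 0"
        using D by (auto simp: D_def)
      have DH: "D * H y = (- ?C (\<nu> + 1) x * ?C \<nu> y) * (dP x * ?P y) * (?C (\<nu> + real n) x * ?C (\<nu> + real m) y)" for y
        by (simp add: D_def H_def)
      note 1 = sign_near_simple_zero[OF dC[OF x z] z nz(1)]
      note 2 = sign_near_simple_zero[OF dP[OF x] common(1) nz(2)]
      note 3 = sign_near_simple_zero[OF dCm[OF x common(2)] common(2) nz(3)]
      have "\<forall>\<^sub>F y in at_left x. D * H y < 0"
        using 1(1) 2(1) 3(1)
        by eventually_elim (unfold DH, rule mult_pos_neg[OF mult_neg_neg])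
      moreover have "\<forall>\<^sub>F y in at_right x. 0 < D * H y"
        using 1(2) 2(2) 3(2)
        by eventually_elim (unfold DH, rule mult_pos_pos[OF mult_pos_pos])
      ultimately show ?thesis using D by (simp add: zero_less_mult_iff mult_less_0_iff)
    qed
  qed
  have at0: "\<forall>\<^sub>F x in at_right 0. 0 < H x"
  proof -
    have "\<forall>\<^sub>F x in at_right 0. x \<in> {0<..<\<nu>}" by (rule eventually_at_right_real[OF \<nu>])
    moreover have "\<forall>\<^sub>F x in at_right 0. 0 < ?C \<nu> x"
      by (rule eventually_cylinder_pos_at_0[OF \<nu> assms(1,2)])
    moreover have "\<forall>\<^sub>F x in at_right 0. 0 < ?C (\<nu> + real m) x"
      using \<nu> by (intro eventually_cylinder_pos_at_0 assms(1,2)) simp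
    ultimately show ?thesis
    proof eventually_elim
      case (elim x)
      then have "0 < ?P x" using \<nu> by (intro lommel_pos) auto
      then show ?case using elim unfolding H_def by (intro mult_pos_pos)
    qed
  qed
  \<comment> \<open>A zero of \<open>C \<nu>\<close> outside \<open>N\<close> is also a zero of
    \<open>C (\<nu> + m)\<close>, hence a point of \<open>\<tau>\<close>.\<close>
  have unbounded: "\<exists>x\<in>N \<union> tau_set \<alpha> m \<nu>. b < x" for b
    using cylinder_zeros_unbounded[OF \<nu>, of \<alpha> b] by (auto simp: cylinder_zeros_def N_def tau)
  have zeros: "H x = 0 \<longleftrightarrow> x \<in> N \<union> tau_set \<alpha> m \<nu>" if "0 < x" for x
    using that by (auto simp: H_def N_def tau)
  have downN: "\<forall>\<^sub>F y in at_left x. 0 < H y" "\<forall>\<^sub>F y in at_right x. H y < 0" if x: "x \<in> N" for x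
  proof -
    obtain D where D: "D < 0" "(H has_real_derivative D) (at x)" "H x = 0" using down[OF x] by blast
    show "\<forall>\<^sub>F y in at_left x. 0 < H y" "\<forall>\<^sub>F y in at_right x. H y < 0"
      using sign_near_simple_zero[OF D(2,3)] D(1) by (simp_all add: zero_less_mult_iff mult_less_0_iff)
  qed
  obtain z where z: "strict_mono z" "increasing_enumeration (\<lambda>l. z (2 * l)) N"
    "increasing_enumeration (\<lambda>l. z (2 * l + 1)) (tau_set \<alpha> m \<nu>)"
    and fin: "\<And>b. finite {x \<in> N \<union> tau_set \<alpha> m \<nu>. x \<le> b}"
    by (rule crossings_alternate[OF contH _ zeros at0 downN conjunct1[OF up] conjunct2[OF up] unbounded])
       (auto simp: N_def tau)
  have fin_zeros: "finite {x \<in> cylinder_zeros \<alpha> \<nu>. x \<le> b}" for b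
    by (rule finite_subset[OF _ fin[of b]]) (auto simp: cylinder_zeros_def N_def tau)
  obtain c where "increasing_enumeration c (cylinder_zeros \<alpha> \<nu>)"
    by (rule ex_increasing_enumeration[OF fin_zeros cylinder_zeros_unbounded[OF \<nu>]])
       (simp_all add: cylinder_zeros_def)
  \<comment> \<open>The noncommon zeros are defined through the range of
    \<open>cylinder_zero\<close>, so its enumeration property must come before their identification
    with \<open>N\<close>.\<close>
  then have c: "increasing_enumeration (cylinder_zero \<alpha> \<nu>) (cylinder_zeros \<alpha> \<nu>)"
    unfolding cylinder_zero_def by (simp add: enumeration_eqI)
  then have "range (cylinder_zero \<alpha> \<nu>) = cylinder_zeros \<alpha> \<nu>" by (simp add: increasing_enumeration_def)
  then have "noncommon_zeros \<alpha> m \<nu> = N"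
    by (auto simp: noncommon_zeros_def common_zeros_def N_def cylinder_zeros_def)
  then have nc: "noncommon_zero \<alpha> m \<nu> = (\<lambda>l. z (2 * l))" "noncommon_zeros \<alpha> m \<nu> = N"
    unfolding noncommon_zero_def using enumeration_eqI[OF z(2)] by simp_all
  have ta: "tau \<alpha> m \<nu> = (\<lambda>l. z (2 * l + 1))"
    unfolding tau_def by (rule enumeration_eqI[OF z(3)])
  have "z (2 * 0) \<in> N" using z(2) unfolding increasing_enumeration_def by blast
  then have "0 < z 0" by (simp add: N_def)
  then show ?thesis
    using c z strict_monoD[OF z(1)] by (simp add: nc ta)
qed

end
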